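(* Let $n\ge 1$ be an integer, $0<s<1$, and set $Q=Q_2(0,0)$, $\tilde Q=Q_1(0,0)$. For every $\alpha\in(0,1)$ there exists a constant $C>0$, independent of $u$ and $f$, such that the following holds. Let $f:\mathbb{R}^n\times\mathbb{R}\to\mathbb{R}$ with $f\ge 0$, let $u\ge 0$ be a classical entire solution of $(\partial_t-\Delta)^s u=f$ in $\mathbb{R}^n\times\mathbb{R}$, let $f_{Q^c}=f$ on $Q^c$ and $f_{Q^c}=0$ on $Q$, and let $$v(x,t)=\int_{-\infty}^t\int_{\mathbb{R}^n} f_{Q^c}(y,\tau)\,G(x-y,t-\tau)\,dy\,d\tau .$$ If $v$ is bounded in $Q$, then $$\|v\|_{C^{2,\alpha}_{x,t}(\tilde Q)}\le C\,\|v\|_{L^\infty(Q)}.$$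
   Context: Cylinders: $Q_r(x^o,t_o)=\{(x,t)\in\mathbb{R}^n\times\mathbb{R}: |x-x^o|<r,\ |t-t_o|<r^2\}$. Operator: for $0<s<1$, $$(\partial_t-\Delta)^s u(x,t)=C_{n,s}\int_{-\infty}^t\int_{\mathbb{R}^n}\frac{u(x,t)-u(y,\tau)}{(t-\tau)^{\frac n2+1+s}}e^{-\frac{|x-y|^2}{4(t-\tau)}}\,dy\,d\tau,\qquad C_{n,s}=\frac{1}{(4\pi)^{n/2}|\Gamma(-s)|},$$ the $y$-integral being in the Cauchy principal value sense. Kernel: $G(x,t)=\dfrac{C_{n,s}}{t^{n/2+1-s}}e^{-\frac{|x|^2}{4t}}$ for $t>0$. Classical entire solution: $u\in C^{2s+\epsilon,s+\epsilon}_{x,t,\mathrm{loc}}(\mathbb{R}^n\times\mathbb{R})\cap\mathcal{L}(\mathbb{R}^n\times\mathbb{R})$ for some $\epsilon>0$ (locally Hölder of order $2s+\epsilon$ in $x$ and $s+\epsilon$ in $t$) and the equation holds pointwise. Here $\mathcal{L}(\mathbb{R}^n\times\mathbb{R})$ is the set of $u\in L^1_{\rm loc}$ with $\int_{-\infty}^t\int_{\mathbb{R}^n}\frac{|u(x,\tau)|e^{-|x|^2/(4(t-\tau))}}{1+(t-\tau)^{n/2+1+s}}\,dx\,d\tau<\infty$ for all $t\in\mathbb{R}$. $C^{2,\alpha}_{x,t}(\tilde Q)$: functions that are $C^2$ in $x$ uniformly in $t$ (with $v$, $\nabla_xv$, $D_x^2v$ bounded) and $C^\alpha$ in $t$ uniformly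 in $x$, with norm the supremum over $t$ of the $C^2$ norm in $x$ plus the supremum over $x$ of the $C^\alpha$ norm in $t$. *)

theory Defs
  imports "HOL-Probability.Probability"
begin

definition cylinder :: "real \<Rightarrow> 'a::euclidean_space \<Rightarrow> real \<Rightarrow> ('a \<times> real) set" where
  "cylinder r x0 t0 = {(x, t). norm (x - x0) < r \<and> \<bar>t - t0\<bar> < r\<^sup>2}"

definition C_const :: "'n::finite itself \<Rightarrow> real \<Rightarrow> real" where
  "C_const _ s = 1 / ((4 * pi) powr (real CARD('n) / 2) * \<bar>Gamma (- s)\<bar>)"

definition has_pv_integral :: "('a::euclidean_space \<Rightarrow> real) \<Rightarrow> 'a \<Rightarrow> real \<Rightarrow> bool" where
  "has_pv_integral g x I \<longleftrightarrow>
     (\<forall>\<epsilon>>0. set_integrable lborel {y. \<epsilon> < norm (y - x)} g) \<and>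
     ((\<lambda>\<epsilon>. LINT y:{y. \<epsilon> < norm (y - x)}|lborel. g y) \<longlongrightarrow> I) (at_right 0)"

text \<open>
  The operator is given as a relation between a function, a point and the value there, so that the
  existence of the integrals is part of it. As for every iterated Lebesgue integral, the inner
  integral is required to exist for almost every \<open>\<tau> < t\<close> only.
\<close>

definition has_frac_heat :: "real \<Rightarrow> ((real^'n) \<times> real \<Rightarrow> real) \<Rightarrow> (real^'n) \<times> real \<Rightarrow> real \<Rightarrow> bool" where
  "has_frac_heat s u = (\<lambda>(x, t) L. \<exists>I.
     (AE \<tau> in lborel. \<tau> < t \<longrightarrow>
        has_pv_integral
          (\<lambda>y. (u (x, t) - u (y, \<tau>)) / (t - \<tau>) powr (real CARD('n) / 2 + 1 + s)
                 * exp (- (norm (x - y))\<^sup>2 / (4 * (t - \<tau>))))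
          x (I \<tau>)) \<and>
     set_integrable lborel {..<t} I \<and>
     L = C_const TYPE('n) s * (LINT \<tau>:{..<t}|lborel. I \<tau>))"

text \<open>
  A family \<open>w i\<close>, \<open>i \<in> J\<close>, of functions that are \<open>C\<^sup>k\<close> on the open set \<open>A\<close> with
  \<open>\<gamma>\<close>-Hoelder derivatives of order \<open>k\<close>, with bounds uniform in \<open>i\<close>.
\<close>

primrec unif_holder ::
    "nat \<Rightarrow> real \<Rightarrow> 'a::euclidean_space set \<Rightarrow> 'i set \<Rightarrow> ('i \<Rightarrow> 'a \<Rightarrow> real) \<Rightarrow> bool" where
  "unif_holder 0 \<gamma> A J w \<longleftrightarrow>
     (\<exists>K. \<forall>i\<in>J. \<forall>x\<in>A. \<bar>w i x\<bar> \<le> K \<and> (\<forall>y\<in>A. \<bar>w i x - w i y\<bar> \<le> K * norm (x - y) powr \<gamma>))"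
| "unif_holder (Suc k) \<gamma> A J w \<longleftrightarrow>
     (\<exists>K. \<forall>i\<in>J. \<forall>x\<in>A. \<bar>w i x\<bar> \<le> K) \<and>
     (\<exists>D. (\<forall>i\<in>J. \<forall>x\<in>A. (w i has_derivative (\<lambda>h. \<Sum>b\<in>Basis. D b i x * (h \<bullet> b))) (at x)) \<and>
          (\<forall>b\<in>Basis. unif_holder k \<gamma> A J (D b)))"

text \<open>Order \<open>\<beta> > 0\<close> means \<open>C\<close>-\<open>(k, \<beta> - k)\<close> with \<open>0 < \<beta> - k \<le> 1\<close>.\<close>

definition unif_holder_order ::
    "real \<Rightarrow> 'a::euclidean_space set \<Rightarrow> 'i set \<Rightarrow> ('i \<Rightarrow> 'a \<Rightarrow> real) \<Rightarrow> bool" where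
  "unif_holder_order \<beta> = (let k = nat (\<lceil>\<beta>\<rceil> - 1) in unif_holder k (\<beta> - real k))"

definition loc_holder :: "real \<Rightarrow> real \<Rightarrow> ('a::euclidean_space \<times> real \<Rightarrow> real) \<Rightarrow> bool" where
  "loc_holder \<beta> \<gamma> u \<longleftrightarrow> (\<forall>R>0.
     unif_holder_order \<beta> (ball 0 R) {-R<..<R} (\<lambda>t x. u (x, t)) \<and>
     unif_holder_order \<gamma> {-R<..<R} (ball 0 R) (\<lambda>x t. u (x, t)))"

definition L_class :: "real \<Rightarrow> ((real^'n) \<times> real \<Rightarrow> real) set" where
  "L_class s = {u. (\<forall>K. compact K \<longrightarrow> set_integrable lborel K u) \<and>
     (\<forall>t. (\<integral>\<^sup>+\<tau>\<in>{..<t}. (\<integral>\<^sup>+x. ennreal (\<bar>u (x, \<tau>)\<bar> * exp (- (norm x)\<^sup>2 / (4 * (t - \<tau>)))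
                 / (1 + (t - \<tau>) powr (real CARD('n) / 2 + 1 + s))) \<partial>lborel) \<partial>lborel) < \<infinity>)}"

definition classical_entire_solution ::
    "real \<Rightarrow> ((real^'n) \<times> real \<Rightarrow> real) \<Rightarrow> ((real^'n) \<times> real \<Rightarrow> real) \<Rightarrow> bool" where
  "classical_entire_solution s u f \<longleftrightarrow>
     (\<exists>\<epsilon>>0. loc_holder (2 * s + \<epsilon>) (s + \<epsilon>) u) \<and> u \<in> L_class s \<and>
     (\<forall>z. has_frac_heat s u z (f z))"

definition G_kernel :: "real \<Rightarrow> real^'n \<Rightarrow> real \<Rightarrow> real" where
  "G_kernel s x t =
     C_const TYPE('n) s / t powr (real CARD('n) / 2 + 1 - s) * exp (- (norm x)\<^sup>2 / (4 * t))"

text \<open>For nonnegative densities; the value may be infinite.\<close>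

definition potential :: "real \<Rightarrow> ((real^'n) \<times> real \<Rightarrow> real) \<Rightarrow> (real^'n) \<times> real \<Rightarrow> ennreal" where
  "potential s g = (\<lambda>(x, t). \<integral>\<^sup>+\<tau>\<in>{..<t}.
     (\<integral>\<^sup>+y. ennreal (g (y, \<tau>) * G_kernel s (x - y) (t - \<tau>)) \<partial>lborel) \<partial>lborel)"

definition Linf_norm :: "('a::euclidean_space \<times> real) set \<Rightarrow> ('a \<times> real \<Rightarrow> real) \<Rightarrow> ennreal" where
  "Linf_norm \<Omega> w = esssup (restrict_space lborel \<Omega>) (\<lambda>z. ennreal \<bar>w z\<bar>)"

definition grad :: "('a::euclidean_space \<Rightarrow> real) \<Rightarrow> 'a \<Rightarrow> 'a" where
  "grad g x = (\<Sum>b\<in>Basis. frechet_derivative g (at x) b *\<^sub>R b)"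

definition hess :: "('a::euclidean_space \<Rightarrow> real) \<Rightarrow> 'a \<Rightarrow> 'a \<Rightarrow> 'a" where
  "hess g x = frechet_derivative (grad g) (at x)"

definition C2_on :: "'a::euclidean_space set \<Rightarrow> ('a \<Rightarrow> real) \<Rightarrow> bool" where
  "C2_on A g \<longleftrightarrow> (\<forall>x\<in>A. g differentiable (at x)) \<and> (\<forall>x\<in>A. grad g differentiable (at x)) \<and>
     (\<forall>h. continuous_on A (\<lambda>x. hess g x h))"

definition C2_norm :: "'a::euclidean_space set \<Rightarrow> ('a \<Rightarrow> real) \<Rightarrow> ennreal" where
  "C2_norm A g = (SUP x\<in>A. ennreal \<bar>g x\<bar>) + (SUP x\<in>A. ennreal (norm (grad g x)))
     + (SUP x\<in>A. ennreal (onorm (hess g x)))"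

definition Calpha_norm :: "real \<Rightarrow> real set \<Rightarrow> (real \<Rightarrow> real) \<Rightarrow> ennreal" where
  "Calpha_norm \<alpha> J h = (SUP t\<in>J. ennreal \<bar>h t\<bar>)
     + (SUP (t, t')\<in>{(t, t'). t \<in> J \<and> t' \<in> J \<and> t \<noteq> t'}. ennreal (\<bar>h t - h t'\<bar> / \<bar>t - t'\<bar> powr \<alpha>))"

definition C2alpha_norm ::
    "real \<Rightarrow> ('a::euclidean_space \<times> real) set \<Rightarrow> ('a \<times> real \<Rightarrow> real) \<Rightarrow> ennreal" where
  "C2alpha_norm \<alpha> \<Omega> w =
     (SUP t\<in>snd ` \<Omega>. C2_norm {x. (x, t) \<in> \<Omega>} (\<lambda>x. w (x, t)))
     + (SUP x\<in>fst ` \<Omega>. Calpha_norm \<alpha> {t. (x, t) \<in> \<Omega>} (\<lambda>t. w (x, t)))"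

definition C2alpha_space ::
    "real \<Rightarrow> ('a::euclidean_space \<times> real) set \<Rightarrow> ('a \<times> real \<Rightarrow> real) set" where
  "C2alpha_space \<alpha> \<Omega> = {w. (\<forall>t\<in>snd ` \<Omega>. C2_on {x. (x, t) \<in> \<Omega>} (\<lambda>x. w (x, t)))
     \<and> C2alpha_norm \<alpha> \<Omega> w < \<infinity>}"

end

theory Submission
  imports Defs
begin

text \<open>
  A source \<open>(y, \<tau>)\<close> outside \<open>Q\<close> that acts on a point \<open>(x, t)\<close> of \<open>Q\<^sub>1(0, 0)\<close> satisfies \<open>norm (x - y) \<ge> 1\<close>
  or \<open>t - \<tau> \<ge> 1\<close>. Therefore the kernel \<open>G(x - y, t - \<tau>)\<close>, even when multiplied by the polynomial
  factors in \<open>norm (x - y) / (t - \<tau>)\<close> that come from differentiation, is dominated by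
  \<open>A * G(x' - y, t' - \<tau>)\<close> for every \<open>(x', t')\<close> with \<open>norm x' < 1\<close> and \<open>2 < t' < 3\<close>: shifting the time
  forward fattens the Gaussian. Differentiating under the integral sign bounds
  the derivatives of \<open>v\<close> in \<open>Q\<^sub>1(0, 0)\<close> by a multiple of the single value \<open>v(x', t')\<close>, and some such
  point satisfies \<open>v(x', t') \<le> esssup v\<close>.
\<close>

subsection \<open>Differentiation under the integral sign\<close>

text \<open>A Lipschitz bound on the derivative turns the mean value inequality into a quadratic
  bound \<open>w \<omega> * (norm (y - x))\<^sup>2\<close> for the first-order remainder.
  Integrating it keeps the square, so the remainder of the integral is of smaller order than
  \<open>norm (y - x)\<close>.\<close>

lemma has_derivative_integral_lipschitz:
  fixes \<phi> :: "'a::euclidean_space \<Rightarrow> 'w \<Rightarrow> 'b::euclidean_space"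
  assumes S: "open S" "convex S" "x \<in> S"
    and int: "\<And>y. y \<in> S \<Longrightarrow> integrable M (\<phi> y)" "\<And>h. integrable M (\<lambda>\<omega>. \<phi>' x \<omega> h)"
    and w: "integrable M w" and w0: "\<And>\<omega>. \<omega> \<in> space M \<Longrightarrow> 0 \<le> w \<omega>"
    and der: "\<And>y \<omega>. y \<in> S \<Longrightarrow> \<omega> \<in> space M \<Longrightarrow> ((\<lambda>y. \<phi> y \<omega>) has_derivative \<phi>' y \<omega>) (at y)"
    and lip: "\<And>y y' \<omega> h. y \<in> S \<Longrightarrow> y' \<in> S \<Longrightarrow> \<omega> \<in> space M \<Longrightarrow>
      norm (\<phi>' y \<omega> h - \<phi>' y' \<omega> h) \<le> w \<omega> * norm (y - y') * norm h"
  shows "((\<lambda>y. \<integral>\<omega>. \<phi> y \<omega> \<partial>M) has_derivative (\<lambda>h. \<integral>\<omega>. \<phi>' x \<omega> h \<partial>M)) (at x)"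
proof -
  define D where "D = (\<lambda>h. \<integral>\<omega>. \<phi>' x \<omega> h \<partial>M)"
  have lin: "bounded_linear (\<phi>' x \<omega>)" if "\<omega> \<in> space M" for \<omega>
    using der[OF S(3) that] by (rule has_derivative_bounded_linear)
  have "linear D"
  proof (rule linearI)
    show "D (a + b) = D a + D b" for a b
      unfolding D_def Bochner_Integration.integral_add[OF int(2) int(2), symmetric]
      by (rule Bochner_Integration.integral_cong) (auto simp: linear_simps[OF lin])
    show "D (r *\<^sub>R a) = r *\<^sub>R D a" for r a
      unfolding D_def integral_scaleR_right[symmetric]
      by (rule Bochner_Integration.integral_cong) (auto simp: linear_simps[OF lin])
  qed
  then have blD: "bounded_linear D"
    by (simp add: linear_conv_bounded_linear)
  have pt: "norm (\<phi> y \<omega> - \<phi> x \<omega> - \<phi>' x \<omega> (y - x)) \<le> w \<omega> * (norm (y - x))\<^sup>2"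
    if y: "y \<in> S" and om: "\<omega> \<in> space M" for y \<omega>
  proof -
    have "norm (\<phi> y \<omega> - \<phi> x \<omega> - \<phi>' x \<omega> (y - x)) \<le> norm (y - x) * (w \<omega> * norm (y - x))"
    proof (rule differentiable_bound_linearization[where S="closed_segment x y" and f'="\<lambda>y. \<phi>' y \<omega>"])
      have sub: "closed_segment x y \<subseteq> S" using S y by (simp add: closed_segment_subset)
      show "x + t *\<^sub>R (y - x) \<in> closed_segment x y" if "t \<in> {0..1}" for t
        using that by (auto simp: closed_segment_def algebra_simps intro!: exI[of _ t])
      show "((\<lambda>y. \<phi> y \<omega>) has_derivative \<phi>' z \<omega>) (at z within closed_segment x y)"
        if "z \<in> closed_segment x y" for z
        using der[OF _ om] that sub by (blast intro: has_derivative_at_withinI)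
      show "onorm (\<phi>' z \<omega> - \<phi>' x \<omega>) \<le> w \<omega> * norm (y - x)" if z: "z \<in> closed_segment x y" for z
      proof (rule onorm_le)
        fix h
        have zS: "z \<in> S" using z sub by blast
        have "norm ((\<phi>' z \<omega> - \<phi>' x \<omega>) h) \<le> w \<omega> * norm (z - x) * norm h"
          using lip[OF zS S(3) om, of h] by simp
        also have "\<dots> \<le> w \<omega> * norm (y - x) * norm h"
          using segment_bound1[OF z] w0[OF om]
          by (intro mult_right_mono mult_left_mono) auto
        finally show "norm ((\<phi>' z \<omega> - \<phi>' x \<omega>) h) \<le> w \<omega> * norm (y - x) * norm h" .
      qed
    qed simp
    then show ?thesis by (simp add: power2_eq_square algebra_simps)
  qed
  show ?thesis
    unfolding has_derivative_at_alt
  proof (intro conjI allI impI)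
    show "bounded_linear (\<lambda>h. \<integral>\<omega>. \<phi>' x \<omega> h \<partial>M)" using blD by (simp add: D_def)
    fix e :: real assume "0 < e"
    \<comment> \<open>The summand 1 keeps the radius \<open>e / B\<close> below meaningful when the
      integral of \<open>w\<close> is zero.\<close>
    define B where "B = \<bar>\<integral>\<omega>. w \<omega> \<partial>M\<bar> + 1"
    have B: "B > 0" by (simp add: B_def)
    obtain d where d: "d > 0" "ball x d \<subseteq> S" using S by (meson openE)
    show "\<exists>d>0. \<forall>y. norm (y - x) < d \<longrightarrow>
        norm ((\<integral>\<omega>. \<phi> y \<omega> \<partial>M) - (\<integral>\<omega>. \<phi> x \<omega> \<partial>M) - (\<integral>\<omega>. \<phi>' x \<omega> (y - x) \<partial>M)) \<le> e * norm (y - x)"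
    proof (intro exI[of _ "min d (e / B)"] conjI allI impI)
      show "min d (e / B) > 0" using d B \<open>0 < e\<close> by simp
      fix y assume y: "norm (y - x) < min d (e / B)"
      then have yS: "y \<in> S" using d(2) by (auto simp: dist_norm norm_minus_commute)
      have "norm ((\<integral>\<omega>. \<phi> y \<omega> \<partial>M) - (\<integral>\<omega>. \<phi> x \<omega> \<partial>M) - (\<integral>\<omega>. \<phi>' x \<omega> (y - x) \<partial>M))
        = norm (\<integral>\<omega>. \<phi> y \<omega> - \<phi> x \<omega> - \<phi>' x \<omega> (y - x) \<partial>M)"
        using int(1)[OF yS] int(1)[OF S(3)] int(2) by simp
      also have "\<dots> \<le> (\<integral>\<omega>. w \<omega> * (norm (y - x))\<^sup>2 \<partial>M)"
        by (rule order_trans[OF integral_norm_bound integral_mono])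
          (use int(1)[OF yS] int(1)[OF S(3)] int(2) w pt[OF yS] in auto)
      also have "\<dots> = (\<integral>\<omega>. w \<omega> \<partial>M) * (norm (y - x))\<^sup>2" by simp
      also have "\<dots> \<le> B * (norm (y - x))\<^sup>2"
        by (rule mult_right_mono) (auto simp: B_def)
      also have "\<dots> = (B * norm (y - x)) * norm (y - x)" by (simp add: power2_eq_square)
      also have "\<dots> \<le> e * norm (y - x)"
        using y B by (intro mult_right_mono) (auto simp: field_simps)
      finally show "norm ((\<integral>\<omega>. \<phi> y \<omega> \<partial>M) - (\<integral>\<omega>. \<phi> x \<omega> \<partial>M) - (\<integral>\<omega>. \<phi>' x \<omega> (y - x) \<partial>M)) \<le> e * norm (y - x)" .
    qed
  qed
qed

subsection \<open>Harnack inequality for the kernel\<close>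

text \<open>Up to its constant factor, the kernel \<open>G\<close> for \<open>p = n/2 + 1 - s\<close>, extended by zero to the future.\<close>

definition heat_ker :: "real \<Rightarrow> 'a::euclidean_space \<Rightarrow> real \<Rightarrow> real" where
  "heat_ker p z \<sigma> = (if 0 < \<sigma> then exp (- (norm z)\<^sup>2 / (4 * \<sigma>)) / \<sigma> powr p else 0)"

lemma heat_ker_nonneg: "0 \<le> heat_ker p z \<sigma>"
  by (simp add: heat_ker_def)

text \<open>The inequality y \<le> exp y at y = \<open>b * (1 + r) / m\<close>, raised to the power
  \<open>m\<close>, lets an exponential absorb any power of \<open>1 + r\<close>.\<close>

lemma powr_mult_exp_bounded:
  fixes m r b :: real
  assumes "m > 0" "r \<ge> 0" "b > 0"
  shows "(1 + r) powr m * exp (- b * r) \<le> (m / b) powr m * exp b"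
proof -
  have "1 + r = (m / b) * (b * (1 + r) / m)" using assms by simp
  also have "\<dots> \<le> (m / b) * exp (b * (1 + r) / m)"
    using assms exp_ge_add_one_self[of "b * (1 + r) / m"]
    by (intro mult_left_mono) (linarith, simp)
  finally have "(1 + r) powr m \<le> ((m / b) * exp (b * (1 + r) / m)) powr m"
    using assms by (intro powr_mono2) auto
  also have "\<dots> = (m / b) powr m * exp (b * (1 + r))"
    using assms by (subst powr_mult) (simp_all add: powr_def[of "exp _"])
  finally have "(1 + r) powr m * exp (- b * r) \<le> (m / b) powr m * exp (b * (1 + r)) * exp (- b * r)"
    by (rule mult_right_mono) simp
  also have "\<dots> = (m / b) powr m * exp b"
    by (simp add: exp_add[symmetric] distrib_left mult.assoc)
  finally show ?thesis .
qed

text \<open>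
  Completing the square gives a gain quadratic in \<open>a / \<sigma>\<close> for large \<open>\<sigma>\<close>; for small \<open>\<sigma>\<close> only
  \<open>a \<ge> 1\<close> provides one, and a gain linear in \<open>a / \<sigma>\<close> is what the two cases have in common.
\<close>

lemma gauss_exponent_gap:
  fixes a \<sigma> \<delta> :: real
  assumes "a \<ge> 0" "\<sigma> > 0" "\<delta> \<ge> 1" "1 \<le> \<sigma> \<or> 1 \<le> a"
  shows "a / \<sigma> / 16 - 21 \<le> a\<^sup>2 / (4 * \<sigma>) - (a + 2)\<^sup>2 / (4 * (\<sigma> + \<delta>))"
proof -
  \<comment> \<open>In these variables the difference of the exponents becomes \<open>r\<^sup>2 *
    \<delta> * q / 4 - r * q - 1 / (\<sigma> + \<delta>)\<close>: one good quadratic term, a linear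
    loss, and a loss of at most 1.\<close>
  define r where "r = a / \<sigma>"
  define q where "q = \<sigma> / (\<sigma> + \<delta>)"
  have a: "a = r * \<sigma>" and r: "r \<ge> 0" using assms by (auto simp: r_def)
  have q: "0 < q" "q \<le> 1" using assms by (auto simp: q_def)
  have "a\<^sup>2 / (4 * \<sigma>) = a\<^sup>2 * (\<sigma> + \<delta>) / (4 * \<sigma> * (\<sigma> + \<delta>))"
    "(a + 2)\<^sup>2 / (4 * (\<sigma> + \<delta>)) = (a + 2)\<^sup>2 * \<sigma> / (4 * \<sigma> * (\<sigma> + \<delta>))"
    using assms by auto
  then have "a\<^sup>2 / (4 * \<sigma>) - (a + 2)\<^sup>2 / (4 * (\<sigma> + \<delta>)) = (a\<^sup>2 * (\<sigma> + \<delta>) - (a + 2)\<^sup>2 * \<sigma>) / (4 * \<sigma> * (\<sigma> + \<delta>))"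
    by (simp only: diff_divide_distrib)
  also have "a\<^sup>2 * (\<sigma> + \<delta>) - (a + 2)\<^sup>2 * \<sigma> = \<sigma> * (r\<^sup>2 * \<sigma> * \<delta> - 4 * r * \<sigma> - 4)"
    unfolding a by (simp add: power2_eq_square algebra_simps)
  also have "\<dots> / (4 * \<sigma> * (\<sigma> + \<delta>)) = r\<^sup>2 * \<delta> * q / 4 - r * q - 1 / (\<sigma> + \<delta>)"
    using assms unfolding q_def by (simp add: divide_simps) (simp add: algebra_simps)
  finally have eq: "a\<^sup>2 / (4 * \<sigma>) - (a + 2)\<^sup>2 / (4 * (\<sigma> + \<delta>)) = r\<^sup>2 * \<delta> * q / 4 - r * q - 1 / (\<sigma> + \<delta>)" .
  have one: "1 / (\<sigma> + \<delta>) \<le> 1" using assms by simp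
  show ?thesis
  \<comment> \<open>Below this threshold the linear loss is at most \<open>r / 16\<close>, while
    \<open>a \<ge> 1\<close> makes the quadratic term at least \<open>r / 8\<close>. Above it,
    \<open>\<delta> * q\<close> is bounded below by \<open>1 / 17\<close> and the quadratic term
    wins for large \<open>r\<close>.\<close>
  proof (cases "\<sigma> < 1 / 16")
    case True
    then have "1 \<le> a" using assms by auto
    have "\<delta> / (\<sigma> + \<delta>) \<ge> 1 / 2" using assms True by (simp add: divide_simps)
    moreover have "r * a \<ge> r" using \<open>1 \<le> a\<close> r by (simp add: mult_le_cancel_left1)
    ultimately have "r * a * (\<delta> / (\<sigma> + \<delta>)) \<ge> r * (1 / 2)"
      using r \<open>1 \<le> a\<close> by (intro mult_mono) auto
    moreover have "r\<^sup>2 * \<delta> * q = r * a * (\<delta> / (\<sigma> + \<delta>))"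
      by (simp add: q_def a power2_eq_square)
    moreover have "q \<le> 1 / 16" using True assms by (simp add: q_def divide_simps)
    then have "r * q \<le> r * (1 / 16)" using r by (intro mult_left_mono) auto
    ultimately show ?thesis unfolding eq r_def[symmetric] using one r by linarith
  next
    case False
    have "\<sigma> + \<delta> \<le> 17 * \<sigma> * \<delta>"
    proof -
      have "\<sigma> * 1 \<le> \<sigma> * \<delta>" "(1/16) * \<delta> \<le> \<sigma> * \<delta>" using assms False by (auto intro!: mult_mono)
      then show ?thesis by linarith
    qed
    then have "\<delta> * q \<ge> 1 / 17" using assms by (simp add: q_def divide_simps mult_ac)
    then have "r\<^sup>2 * (\<delta> * q) \<ge> r\<^sup>2 * (1 / 17)" by (intro mult_left_mono) auto
    moreover have "r * q \<le> r * 1" using r q by (intro mult_left_mono) auto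
    \<comment> \<open>The quadratic term is at least \<open>r\<^sup>2 / 68\<close> and must beat
      \<open>r + r / 16\<close>. Completing this square costs a constant below 20; the last loss of
      1 brings it to 21.\<close>
    moreover have "0 \<le> (r - 289/8)\<^sup>2" by simp
    then have "r\<^sup>2 / 68 \<ge> 17/16 * r - 20" by (simp add: power2_eq_square algebra_simps)
    ultimately show ?thesis unfolding eq r_def[symmetric] using one by (simp add: mult.assoc)
  qed
qed

text \<open>
  The cube leaves room for three space derivatives, each of which costs a factor \<open>norm z / \<sigma>\<close>
  or (at most) \<open>1 + norm z / \<sigma>\<close>.
\<close>

lemma heat_ker_harnack:
  assumes p: "p > 0"
  obtains A where "A > 0" "\<And>(z::'a::euclidean_space) z' \<sigma> \<delta>. \<lbrakk>\<sigma> > 0; 1 \<le> \<delta>; \<delta> \<le> 4; norm (z' - z) \<le> 2; 1 \<le> \<sigma> \<or> 1 \<le> norm z\<rbrakk> \<Longrightarrow>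
    (1 + norm z / \<sigma>) ^ 3 * heat_ker p z \<sigma> \<le> A * heat_ker p z' (\<sigma> + \<delta>)"
proof -
  \<comment> \<open>Three powers of \<open>1 + r\<close> come from the cube and \<open>p\<close>
    more from comparing \<open>1 / \<sigma> powr p\<close> with
    \<open>1 / (\<sigma> + \<delta>) powr p\<close>.\<close>
  define m where "m = 3 + p"
  define A0 where "A0 = (m / (1/16)) powr m * exp (1/16)"
  \<comment> \<open>The 5 comes from
    \<open>(\<sigma> + \<delta>) / \<sigma> \<le> 5 * (1 + r)\<close>, the 21 from the gap of the
    Gaussian exponents, and \<open>A0\<close> bounds \<open>(1 + r) powr m\<close> against the
    gained factor \<open>exp (- (1/16) * r)\<close>.\<close>
  define A where "A = 5 powr p * exp 21 * A0"
  have m: "m > 0" using p by (simp add: m_def)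
  have A0: "A0 > 0" using m by (simp add: A0_def)
  have "(1 + norm z / \<sigma>) ^ 3 * heat_ker p z \<sigma> \<le> A * heat_ker p z' (\<sigma> + \<delta>)"
    if s: "\<sigma> > 0" and d: "1 \<le> \<delta>" "\<delta> \<le> 4" and zz: "norm (z' - z) \<le> 2" and c: "1 \<le> \<sigma> \<or> 1 \<le> norm z"
    for z z' :: 'a and \<sigma> \<delta>
  proof -
    define r where "r = norm z / \<sigma>"
    have r: "r \<ge> 0" using s by (simp add: r_def)
    \<comment> \<open>Here the separation from the source pays: negative powers of \<sigma> are
      controlled by \<open>r\<close>, either because \<sigma> is large or because
      \<open>norm z\<close> is.\<close>
    have q: "1 / \<sigma> \<le> 1 + r"
    proof (cases "1 \<le> \<sigma>")
      case True then have "1 / \<sigma> \<le> 1" by simp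
      then show ?thesis using r by linarith
    next
      case False then have "1 / \<sigma> \<le> r" using c s by (simp add: r_def divide_right_mono)
      then show ?thesis by simp
    qed
    have "(\<sigma> + \<delta>) / \<sigma> = 1 + \<delta> * (1 / \<sigma>)" using s by (simp add: field_simps)
    also have "\<dots> \<le> 1 + 4 * (1 + r)" using q d s r by (intro add_left_mono mult_mono) auto
    also have "\<dots> \<le> 5 * (1 + r)" using r by simp
    finally have "((\<sigma> + \<delta>) / \<sigma>) powr p \<le> (5 * (1 + r)) powr p"
      using s d p by (intro powr_mono2) auto
    then have "(\<sigma> + \<delta>) powr p / \<sigma> powr p \<le> 5 powr p * (1 + r) powr p"
      using s d r powr_mult[of 5 "1 + r" p] by (simp add: powr_divide del: distrib_left_numeral)
    then have pw: "1 / \<sigma> powr p \<le> 5 powr p * (1 + r) powr p / (\<sigma> + \<delta>) powr p"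
      using s d by (simp add: pos_le_divide_eq)
    have "norm z' \<le> norm z + 2" using zz norm_triangle_sub[of z' z] by linarith
    then have "(norm z')\<^sup>2 / (4 * (\<sigma> + \<delta>)) \<le> (norm z + 2)\<^sup>2 / (4 * (\<sigma> + \<delta>))"
      using s d by (intro divide_right_mono power_mono) auto
    with gauss_exponent_gap[of "norm z" \<sigma> \<delta>] s d c
    have ex: "exp (- (norm z)\<^sup>2 / (4 * \<sigma>)) \<le> exp (- (1/16) * r) * exp 21 * exp (- (norm z')\<^sup>2 / (4 * (\<sigma> + \<delta>)))"
      unfolding exp_add[symmetric] r_def[symmetric] by simp
    have "(1 + r) ^ 3 * heat_ker p z \<sigma> = (1 + r) ^ 3 * ((1 / \<sigma> powr p) * exp (- (norm z)\<^sup>2 / (4 * \<sigma>)))"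
      using s by (simp add: heat_ker_def)
    also have "\<dots> \<le> (1 + r) ^ 3 * ((5 powr p * (1 + r) powr p / (\<sigma> + \<delta>) powr p) * (exp (- (1/16) * r) * exp 21 * exp (- (norm z')\<^sup>2 / (4 * (\<sigma> + \<delta>)))))"
      using r pw ex by (intro mult_left_mono mult_mono) auto
    also have "\<dots> = 5 powr p * exp 21 * ((1 + r) powr m * exp (- (1/16) * r)) * heat_ker p z' (\<sigma> + \<delta>)"
    proof -
      have "(1 + r) powr m = (1 + r) ^ 3 * (1 + r) powr p"
        using r powr_realpow[of "1 + r" 3] by (simp add: m_def powr_add)
      then show ?thesis using s d by (simp add: heat_ker_def)
    qed
    also have "\<dots> \<le> 5 powr p * exp 21 * A0 * heat_ker p z' (\<sigma> + \<delta>)"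
      using powr_mult_exp_bounded[OF m r, of "1/16"] unfolding A0_def
      by (intro mult_right_mono mult_left_mono) (auto simp: heat_ker_nonneg)
    finally show ?thesis by (simp add: A_def r_def)
  qed
  moreover have "A > 0" using A0 by (simp add: A_def)
  ultimately show ?thesis using that by blast
qed

subsection \<open>Derivatives of the kernel\<close>

lemma measurable_heat_ker' [measurable (raw)]:
  assumes [measurable]: "f \<in> borel_measurable M" "g \<in> borel_measurable M"
  shows "(\<lambda>\<omega>. heat_ker p (f \<omega> :: 'a::euclidean_space) (g \<omega>)) \<in> borel_measurable M"
  unfolding heat_ker_def by measurable

text \<open>Since \<open>heat_ker\<close> vanishes for \<sigma> \<le> 0, this formula and the two
  after it give the correct space derivatives at every \<sigma>.\<close>

definition heat_ker_grad :: "real \<Rightarrow> 'a::euclidean_space \<Rightarrow> real \<Rightarrow> 'a" where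
  "heat_ker_grad p z \<sigma> = - (heat_ker p z \<sigma> / (2 * \<sigma>)) *\<^sub>R z"

definition heat_ker_hess :: "real \<Rightarrow> 'a::euclidean_space \<Rightarrow> real \<Rightarrow> 'a \<Rightarrow> 'a" where
  "heat_ker_hess p z \<sigma> h =
     heat_ker p z \<sigma> *\<^sub>R ((z \<bullet> h / (4 * \<sigma>\<^sup>2)) *\<^sub>R z - (1 / (2 * \<sigma>)) *\<^sub>R h)"

text \<open>The vector \<open>h\<close> stays fixed and \<open>k\<close> is the new direction of
  differentiation. The third derivative serves to make the Hessian Lipschitz in space.\<close>

definition heat_ker_third :: "real \<Rightarrow> 'a::euclidean_space \<Rightarrow> real \<Rightarrow> 'a \<Rightarrow> 'a \<Rightarrow> 'a" where
  "heat_ker_third p z \<sigma> h k =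
     (heat_ker_grad p z \<sigma> \<bullet> k) *\<^sub>R ((z \<bullet> h / (4 * \<sigma>\<^sup>2)) *\<^sub>R z - (1 / (2 * \<sigma>)) *\<^sub>R h)
     + heat_ker p z \<sigma> *\<^sub>R ((k \<bullet> h / (4 * \<sigma>\<^sup>2)) *\<^sub>R z + (z \<bullet> h / (4 * \<sigma>\<^sup>2)) *\<^sub>R k)"

lemma has_derivative_heat_ker:
  "((\<lambda>z. heat_ker p z \<sigma>) has_derivative (\<lambda>h. heat_ker_grad p z \<sigma> \<bullet> h)) (at z)"
proof (cases "\<sigma> > 0")
  case True
  have "((\<lambda>z. exp (- (z \<bullet> z) / (4 * \<sigma>)) / \<sigma> powr p) has_derivative
      (\<lambda>h. exp (- (z \<bullet> z) / (4 * \<sigma>)) / \<sigma> powr p * (- (z \<bullet> h) / (2 * \<sigma>)))) (at z)"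
    using True by (auto intro!: derivative_eq_intros simp: inner_commute field_simps)
  with True show ?thesis
    by (simp add: heat_ker_def heat_ker_grad_def power2_norm_eq_inner)
qed (simp add: heat_ker_def heat_ker_grad_def)

lemma has_derivative_heat_ker_grad:
  "((\<lambda>z. heat_ker_grad p z \<sigma>) has_derivative heat_ker_hess p z \<sigma>) (at z)"
proof -
  \<comment> \<open>An arbitrary constant \<open>c\<close> in place of
    \<open>1 / (2 * \<sigma>)\<close> keeps divisions, and with them the sign of \<sigma>, out of
    the derivative rules.\<close>
  have "((\<lambda>z. - (heat_ker p z \<sigma> * c) *\<^sub>R z) has_derivative
    (\<lambda>h. - (heat_ker_grad p z \<sigma> \<bullet> h * c) *\<^sub>R z - (heat_ker p z \<sigma> * c) *\<^sub>R h)) (at z)" for c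
    by (rule derivative_eq_intros has_derivative_heat_ker refl)+ (simp add: fun_eq_iff algebra_simps)
  from this[of "1 / (2 * \<sigma>)"] show ?thesis
    by (simp add: heat_ker_grad_def heat_ker_hess_def[abs_def] algebra_simps power2_eq_square)
qed

lemma has_derivative_heat_ker_hess:
  "((\<lambda>z. heat_ker_hess p z \<sigma> h) has_derivative heat_ker_third p z \<sigma> h) (at z)"
proof -
  have "((\<lambda>z. heat_ker p z \<sigma> *\<^sub>R ((z \<bullet> h * c) *\<^sub>R z - d *\<^sub>R h)) has_derivative
    (\<lambda>k. (heat_ker_grad p z \<sigma> \<bullet> k) *\<^sub>R ((z \<bullet> h * c) *\<^sub>R z - d *\<^sub>R h)
      + heat_ker p z \<sigma> *\<^sub>R ((k \<bullet> h * c) *\<^sub>R z + (z \<bullet> h * c) *\<^sub>R k))) (at z)" for c d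
    by (rule derivative_eq_intros has_derivative_heat_ker refl)+ (simp add: fun_eq_iff algebra_simps)
  from this[of "1 / (4 * \<sigma>\<^sup>2)" "1 / (2 * \<sigma>)"] show ?thesis
    by (simp add: heat_ker_hess_def heat_ker_third_def[abs_def])
qed

lemma has_derivative_translate:
  "(f has_derivative f') (at (x - y)) \<Longrightarrow> ((\<lambda>x. f (x - y)) has_derivative f') (at x)"
  using has_derivative_compose[of "\<lambda>x. x - y" "\<lambda>h. h" x UNIV f f']
    has_derivative_diff[OF has_derivative_ident has_derivative_const[of y]]
  by simp

text \<open>Stated for positive \<sigma> because, for \<open>p > 0\<close> and \<open>z = 0\<close>,
  the kernel blows up as \<sigma> decreases to 0; \<open>lipschitz_time\<close> treats the passage
  through that moment separately.\<close>

lemma has_real_derivative_heat_ker_time: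
  assumes "\<sigma> > 0"
  shows "((\<lambda>\<sigma>. heat_ker p z \<sigma>) has_real_derivative
    heat_ker p z \<sigma> * ((norm z / \<sigma>)\<^sup>2 / 4 - p / \<sigma>)) (at \<sigma>)"
proof -
  define c where "c = (norm z)\<^sup>2 / 4"
  have "((\<lambda>\<sigma>. exp (- c / \<sigma>)) has_real_derivative exp (- c / \<sigma>) * (c / \<sigma>\<^sup>2)) (at \<sigma>)"
    using assms by (auto intro!: derivative_eq_intros simp: power2_eq_square)
  from DERIV_mult[OF this has_real_derivative_powr[OF assms, of "- p"]]
  have "((\<lambda>\<sigma>. exp (- c / \<sigma>) * \<sigma> powr (- p)) has_real_derivative
    heat_ker p z \<sigma> * (c / \<sigma>\<^sup>2 - p / \<sigma>)) (at \<sigma>)"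
  proof (rule DERIV_cong)
    have "heat_ker p z \<sigma> = exp (- c / \<sigma>) * \<sigma> powr (- p)"
      using assms by (simp add: heat_ker_def c_def powr_minus_divide)
    moreover have "\<sigma> powr (- p - 1) = \<sigma> powr (- p) / \<sigma>"
      using assms by (simp add: powr_diff)
    ultimately show "exp (- c / \<sigma>) * (c / \<sigma>\<^sup>2) * \<sigma> powr (- p) + - p * \<sigma> powr (- p - 1) * exp (- c / \<sigma>)
      = heat_ker p z \<sigma> * (c / \<sigma>\<^sup>2 - p / \<sigma>)"
      by (simp add: right_diff_distrib mult_ac)
  qed
  then have "((\<lambda>\<sigma>. heat_ker p z \<sigma>) has_real_derivative heat_ker p z \<sigma> * (c / \<sigma>\<^sup>2 - p / \<sigma>)) (at \<sigma>)"
    by (rule has_field_derivative_transform_within_open[where S="{0<..}"])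
      (use assms in \<open>auto simp: heat_ker_def c_def powr_minus_divide\<close>)
  then show ?thesis by (simp add: c_def power_divide mult.commute)
qed

text \<open>Every derivative equals the kernel times an expression bounded by a polynomial in
  \<open>r = norm z / \<sigma>\<close> and \<open>q = 1 / \<sigma>\<close>. The hypothesis replaces
  \<open>q\<close> by \<open>1 + r\<close>, and what results is dominated by the expanded cube
  \<open>(1 + r) ^ 3\<close>, up to the factor \<open>1 + p\<close> for the time derivative.\<close>

lemma
  fixes z h k :: "'a::euclidean_space" and p \<sigma> :: real
  assumes "\<sigma> > 0 \<Longrightarrow> 1 / \<sigma> \<le> 1 + norm z / \<sigma>"
  defines "B \<equiv> (1 + norm z / \<sigma>) ^ 3 * heat_ker p z \<sigma>"
  shows heat_ker_le: "heat_ker p z \<sigma> \<le> B"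
    and heat_ker_over_time_le: "1 / \<sigma> * heat_ker p z \<sigma> \<le> B"
    and norm_heat_ker_grad_le: "norm (heat_ker_grad p z \<sigma>) \<le> B"
    and norm_heat_ker_hess_le: "norm (heat_ker_hess p z \<sigma> h) \<le> B * norm h"
    and norm_heat_ker_third_le: "norm (heat_ker_third p z \<sigma> h k) \<le> B * norm h * norm k"
    and heat_ker_time_deriv_le:
      "p > 0 \<Longrightarrow> \<bar>heat_ker p z \<sigma> * ((norm z / \<sigma>)\<^sup>2 / 4 - p / \<sigma>)\<bar> \<le> (1 + p) * B"
proof -
  define K where "K = heat_ker p z \<sigma>"
  define r where "r = norm z / \<sigma>"
  define q where "q = 1 / \<sigma>"
  have K: "K \<ge> 0" by (simp add: K_def heat_ker_nonneg)
  have "heat_ker p z \<sigma> \<le> B \<and> 1 / \<sigma> * heat_ker p z \<sigma> \<le> B \<and> norm (heat_ker_grad p z \<sigma>) \<le> B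
    \<and> norm (heat_ker_hess p z \<sigma> h) \<le> B * norm h
    \<and> norm (heat_ker_third p z \<sigma> h k) \<le> B * norm h * norm k
    \<and> (p > 0 \<longrightarrow> \<bar>heat_ker p z \<sigma> * ((norm z / \<sigma>)\<^sup>2 / 4 - p / \<sigma>)\<bar> \<le> (1 + p) * B)"
  proof (cases "\<sigma> > 0")
    case False
    then show ?thesis
      by (simp add: B_def heat_ker_def heat_ker_grad_def heat_ker_hess_def heat_ker_third_def)
  next
    case True
    have r: "r \<ge> 0" and q: "q \<ge> 0" "q \<le> 1 + r" using True assms(1) by (auto simp: r_def q_def)
    have z: "norm z = r * \<sigma>" using True by (simp add: r_def)
    have s: "\<sigma> = 1 / q" "q > 0" using True by (auto simp: q_def)
    have B: "B = K * (1 + r) ^ 3" by (simp add: B_def K_def r_def)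
    have cube: "(1 + r) ^ 3 = 1 + 3 * r + 3 * r\<^sup>2 + r ^ 3"
      by (simp add: power3_eq_cube power2_eq_square algebra_simps)
    have r2: "0 \<le> r\<^sup>2" "0 \<le> r ^ 3" using r by auto
    have rq: "r * q \<le> r + r\<^sup>2" using mult_left_mono[OF q(2) r] by (simp add: power2_eq_square algebra_simps)
    have 1: "K \<le> B" unfolding B using K cube r r2 by (simp add: mult_le_cancel_left1)
    have 2: "q * K \<le> B" unfolding B mult.commute[of q]
      using cube r r2 q by (intro mult_left_mono K) linarith
    have grad_eq: "norm (heat_ker_grad p z \<sigma>) = K * (r / 2)"
      using True K by (simp add: heat_ker_grad_def K_def r_def)
    have 3: "norm (heat_ker_grad p z \<sigma>) \<le> B" unfolding grad_eq B
      using cube r r2 by (intro mult_left_mono K) linarith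
    have brack: "norm ((z \<bullet> h / (4 * \<sigma>\<^sup>2)) *\<^sub>R z - (1 / (2 * \<sigma>)) *\<^sub>R h) \<le> (r\<^sup>2 / 4 + q / 2) * norm h"
    proof -
      have "norm ((z \<bullet> h / (4 * \<sigma>\<^sup>2)) *\<^sub>R z) = \<bar>z \<bullet> h\<bar> * norm z / (4 * \<sigma>\<^sup>2)" by simp
      also have "\<dots> \<le> norm z * norm h * norm z / (4 * \<sigma>\<^sup>2)"
        by (intro divide_right_mono mult_right_mono Cauchy_Schwarz_ineq2) auto
      also have "\<dots> = r\<^sup>2 / 4 * norm h" using True by (simp add: r_def power2_eq_square mult_ac)
      finally have "norm ((z \<bullet> h / (4 * \<sigma>\<^sup>2)) *\<^sub>R z) \<le> r\<^sup>2 / 4 * norm h" .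
      moreover have "norm ((1 / (2 * \<sigma>)) *\<^sub>R h) = q / 2 * norm h" using True by (simp add: q_def)
      ultimately show ?thesis
        using norm_triangle_ineq4[of "(z \<bullet> h / (4 * \<sigma>\<^sup>2)) *\<^sub>R z" "(1 / (2 * \<sigma>)) *\<^sub>R h"]
        by (simp add: algebra_simps)
    qed
    have "norm (heat_ker_hess p z \<sigma> h) \<le> K * ((r\<^sup>2 / 4 + q / 2) * norm h)"
      unfolding heat_ker_hess_def norm_scaleR K_def[symmetric] using K brack
      by (simp add: mult_left_mono)
    also have "\<dots> \<le> K * ((1 + r) ^ 3 * norm h)"
      using cube r r2 q by (intro mult_left_mono mult_right_mono K) (linarith, simp)
    finally have 4: "norm (heat_ker_hess p z \<sigma> h) \<le> B * norm h" by (simp add: B mult.assoc)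
    have t1: "norm ((heat_ker_grad p z \<sigma> \<bullet> k) *\<^sub>R ((z \<bullet> h / (4 * \<sigma>\<^sup>2)) *\<^sub>R z - (1 / (2 * \<sigma>)) *\<^sub>R h))
      \<le> (K * (r / 2) * norm k) * ((r\<^sup>2 / 4 + q / 2) * norm h)"
      unfolding norm_scaleR
      using Cauchy_Schwarz_ineq2[of "heat_ker_grad p z \<sigma>" k] brack K r
      by (intro mult_mono) (auto simp: grad_eq)
    have t2: "norm ((k \<bullet> h / (4 * \<sigma>\<^sup>2)) *\<^sub>R z) \<le> r * q / 4 * (norm h * norm k)"
    proof -
      have "norm ((k \<bullet> h / (4 * \<sigma>\<^sup>2)) *\<^sub>R z) = \<bar>k \<bullet> h\<bar> * norm z / (4 * \<sigma>\<^sup>2)" by simp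
      also have "\<dots> \<le> norm k * norm h * norm z / (4 * \<sigma>\<^sup>2)"
        by (intro divide_right_mono mult_right_mono Cauchy_Schwarz_ineq2) auto
      also have "\<dots> = r * q / 4 * (norm h * norm k)" using True by (simp add: r_def q_def power2_eq_square mult_ac)
      finally show ?thesis .
    qed
    have t3: "norm ((z \<bullet> h / (4 * \<sigma>\<^sup>2)) *\<^sub>R k) \<le> r * q / 4 * (norm h * norm k)"
    proof -
      have "norm ((z \<bullet> h / (4 * \<sigma>\<^sup>2)) *\<^sub>R k) = \<bar>z \<bullet> h\<bar> * norm k / (4 * \<sigma>\<^sup>2)" by simp
      also have "\<dots> \<le> norm z * norm h * norm k / (4 * \<sigma>\<^sup>2)"
        by (intro divide_right_mono mult_right_mono Cauchy_Schwarz_ineq2) auto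
      also have "\<dots> = r * q / 4 * (norm h * norm k)" using True by (simp add: r_def q_def power2_eq_square mult_ac)
      finally show ?thesis .
    qed
    have "norm (heat_ker_third p z \<sigma> h k) \<le>
        (K * (r / 2) * norm k) * ((r\<^sup>2 / 4 + q / 2) * norm h)
        + K * (r * q / 4 * (norm h * norm k) + r * q / 4 * (norm h * norm k))"
      unfolding heat_ker_third_def K_def[symmetric]
      using mult_left_mono[OF norm_triangle_le[OF add_mono[OF t2 t3]] K] K
      by (intro order_trans[OF norm_triangle_ineq] add_mono t1) simp
    \<comment> \<open>The coefficient 3/4 collects 1/4 from the first product and twice 1/4 from
      \<open>t2\<close> and \<open>t3\<close>.\<close>
    also have "\<dots> = K * ((r ^ 3 / 8 + 3 / 4 * (r * q)) * (norm h * norm k))"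
      by (simp add: power3_eq_cube power2_eq_square algebra_simps)
    also have "\<dots> \<le> K * ((1 + r) ^ 3 * (norm h * norm k))"
      using cube r r2 rq by (intro mult_left_mono mult_right_mono K) (linarith, simp)
    finally have 5: "norm (heat_ker_third p z \<sigma> h k) \<le> B * norm h * norm k" by (simp add: B mult.assoc)
    have 6: "\<bar>K * (r\<^sup>2 / 4 - p * q)\<bar> \<le> (1 + p) * B" if p: "p > 0"
    proof -
      have "\<bar>r\<^sup>2 / 4 - p * q\<bar> \<le> r\<^sup>2 + p * q" using p q(1) r2 mult_nonneg_nonneg[of p q] by linarith
      also have "\<dots> \<le> (1 + r) ^ 3 + p * (1 + r) ^ 3"
        using cube r r2 q p by (intro add_mono mult_left_mono) linarith+
      finally have "K * \<bar>r\<^sup>2 / 4 - p * q\<bar> \<le> K * ((1 + p) * (1 + r) ^ 3)"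
        by (intro mult_left_mono K) (simp add: distrib_right)
      then show ?thesis using K by (simp add: abs_mult B mult_ac)
    qed
    then have "\<bar>K * (r\<^sup>2 / 4 - p / \<sigma>)\<bar> \<le> (1 + p) * B" if "p > 0" using that by (simp add: q_def)
    with 1 2 3 4 5 show ?thesis unfolding K_def q_def r_def by blast
  qed
  then show "heat_ker p z \<sigma> \<le> B" "1 / \<sigma> * heat_ker p z \<sigma> \<le> B" "norm (heat_ker_grad p z \<sigma>) \<le> B"
    "norm (heat_ker_hess p z \<sigma> h) \<le> B * norm h"
    "norm (heat_ker_third p z \<sigma> h k) \<le> B * norm h * norm k"
    "p > 0 \<Longrightarrow> \<bar>heat_ker p z \<sigma> * ((norm z / \<sigma>)\<^sup>2 / 4 - p / \<sigma>)\<bar> \<le> (1 + p) * B"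
    by blast+
qed

subsection \<open>Potentials of distant sources\<close>

text \<open>
  A measure \<open>M\<close> of sources outside \<open>Q\<close>, and a reference point \<open>(x', t')\<close> of \<open>Q\<close> that is later than
  all of \<open>Q\<^sub>1(0, 0)\<close>, at which the potential of \<open>M\<close> is finite.
\<close>

locale past_sources =
  fixes p A :: real and M :: "('a::euclidean_space \<times> real) measure" and x' :: 'a and t' :: real
  assumes p: "p > 0"
    and harnack: "\<And>(z::'a) z' \<sigma> \<delta>. \<lbrakk>\<sigma> > 0; 1 \<le> \<delta>; \<delta> \<le> 4; norm (z' - z) \<le> 2; 1 \<le> \<sigma> \<or> 1 \<le> norm z\<rbrakk> \<Longrightarrow>
      (1 + norm z / \<sigma>) ^ 3 * heat_ker p z \<sigma> \<le> A * heat_ker p z' (\<sigma> + \<delta>)"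
    and A: "A > 0"
    and outside: "space M \<inter> cylinder 2 0 0 = {}"
    and ident: "(\<lambda>\<omega>. \<omega>) \<in> borel_measurable M"
    and reference: "norm x' < 1" "2 < t'" "t' < 3"
    and integrable_reference: "integrable M (\<lambda>\<omega>. heat_ker p (x' - fst \<omega>) (t' - snd \<omega>))"
begin

text \<open>The common majorant, independent of the point of \<open>cylinder 1 0 0\<close>, for the
  kernel and its space derivatives.\<close>

definition w :: "'a \<times> real \<Rightarrow> real" where
  "w \<omega> = A * heat_ker p (x' - fst \<omega>) (t' - snd \<omega>)"

definition W :: real where
  "W = (\<integral>\<omega>. w \<omega> \<partial>M)"

text \<open>The potential of the sources; \<Gamma> and \<open>H\<close> are the candidates for its
  space gradient and Hessian, obtained by differentiating the kernel.\<close>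

definition \<Phi> :: "'a \<Rightarrow> real \<Rightarrow> real" where
  "\<Phi> x t = (\<integral>\<omega>. heat_ker p (x - fst \<omega>) (t - snd \<omega>) \<partial>M)"

definition \<Gamma> :: "'a \<Rightarrow> real \<Rightarrow> 'a" where
  "\<Gamma> x t = (\<integral>\<omega>. heat_ker_grad p (x - fst \<omega>) (t - snd \<omega>) \<partial>M)"

definition H :: "'a \<Rightarrow> real \<Rightarrow> 'a \<Rightarrow> 'a" where
  "H x t h = (\<integral>\<omega>. heat_ker_hess p (x - fst \<omega>) (t - snd \<omega>) h \<partial>M)"

lemma measurable_fst_snd [measurable]: "fst \<in> borel_measurable M" "snd \<in> borel_measurable M"
  by (auto intro!: measurable_compose[OF ident] borel_measurable_continuous_onI continuous_on_fst continuous_on_snd)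

lemma w_nonneg: "0 \<le> w \<omega>"
  using A by (simp add: w_def heat_ker_nonneg)

lemma integrable_w: "integrable M w"
  unfolding w_def using integrable_reference by simp

lemma W_nonneg: "0 \<le> W"
  unfolding W_def using w_nonneg by (simp add: integral_nonneg_AE)

lemma W_eq: "W = A * \<Phi> x' t'"
  unfolding W_def w_def \<Phi>_def by simp

text \<open>A source with \<open>norm (fst \<omega>) \<ge> 2\<close> is at distance at least 1 from
  the unit ball. Otherwise its time has modulus at least 4, and lying in the past of
  \<open>t < 1\<close> it must precede \<open>t\<close> by more than 1.\<close>

lemma far:
  assumes "norm x < 1" "\<bar>t\<bar> < 1" "\<omega> \<in> space M" "t - snd \<omega> > 0"
  shows "1 \<le> t - snd \<omega> \<or> 1 \<le> norm (x - fst \<omega>)"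
proof -
  have "\<omega> \<notin> cylinder 2 0 0" using outside assms(3) by blast
  then have "norm (fst \<omega>) \<ge> 2 \<or> \<bar>snd \<omega>\<bar> \<ge> 4"
    by (cases \<omega>) (auto simp: cylinder_def not_less)
  moreover have "norm (fst \<omega>) \<le> norm x + norm (x - fst \<omega>)"
    by (metis norm_triangle_sub norm_minus_commute)
  ultimately show ?thesis using assms by linarith
qed

text \<open>Translates the separation from the source into the premise of the kernel bounds.\<close>

lemma time_inverse_le:
  assumes "norm x < 1" "\<bar>t\<bar> < 1" "\<omega> \<in> space M" "t - snd \<omega> > 0"
  shows "1 / (t - snd \<omega>) \<le> 1 + norm (x - fst \<omega>) / (t - snd \<omega>)"
  using far[OF assms]
proof
  assume "1 \<le> t - snd \<omega>"
  then have "1 / (t - snd \<omega>) \<le> 1" by simp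
  then show ?thesis using assms(4) by (smt (verit) divide_nonneg_pos norm_ge_zero)
next
  assume "1 \<le> norm (x - fst \<omega>)"
  then have "1 / (t - snd \<omega>) \<le> norm (x - fst \<omega>) / (t - snd \<omega>)"
    using assms(4) by (intro divide_right_mono) auto
  then show ?thesis by simp
qed

text \<open>The time shift \<open>t' - t\<close> lies between 1 and 4 and the space shift
  \<open>x' - x\<close> has norm below 2, which is the range covered by the Harnack inequality. For
  sources not in the past the left side vanishes.\<close>

lemma harnack_w:
  assumes "norm x < 1" "\<bar>t\<bar> < 1" "\<omega> \<in> space M"
  shows "(1 + norm (x - fst \<omega>) / (t - snd \<omega>)) ^ 3 * heat_ker p (x - fst \<omega>) (t - snd \<omega>) \<le> w \<omega>"
proof (cases "t - snd \<omega> > 0")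
  case True
  have "norm (x' - x) \<le> 2" using reference assms norm_triangle_ineq4[of x' x] by linarith
  then show ?thesis
    using harnack[OF True, of "t' - t" "x' - fst \<omega>" "x - fst \<omega>"] far[OF assms True] reference assms
    by (simp add: w_def)
qed (use w_nonneg[of \<omega>] in \<open>simp add: heat_ker_def\<close>)

lemma pointwise_bounds:
  assumes "norm x < 1" "\<bar>t\<bar> < 1" "\<omega> \<in> space M"
  defines "z \<equiv> x - fst \<omega>" and "\<sigma> \<equiv> t - snd \<omega>"
  shows "heat_ker p z \<sigma> \<le> w \<omega>"
    and "1 / \<sigma> * heat_ker p z \<sigma> \<le> w \<omega>"
    and "norm (heat_ker_grad p z \<sigma>) \<le> w \<omega>"
    and "norm (heat_ker_hess p z \<sigma> h) \<le> w \<omega> * norm h"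
    and "norm (heat_ker_third p z \<sigma> h k) \<le> w \<omega> * norm h * norm k"
    and "\<bar>heat_ker p z \<sigma> * ((norm z / \<sigma>)\<^sup>2 / 4 - p / \<sigma>)\<bar> \<le> (1 + p) * w \<omega>"
proof -
  note w = harnack_w[OF assms(1-3), folded z_def \<sigma>_def]
  have q: "\<sigma> > 0 \<Longrightarrow> 1 / \<sigma> \<le> 1 + norm z / \<sigma>"
    unfolding z_def \<sigma>_def using time_inverse_le[OF assms(1-3)] .
  show "heat_ker p z \<sigma> \<le> w \<omega>" "1 / \<sigma> * heat_ker p z \<sigma> \<le> w \<omega>" "norm (heat_ker_grad p z \<sigma>) \<le> w \<omega>"
    using heat_ker_le[OF q, of p] heat_ker_over_time_le[OF q, of p] norm_heat_ker_grad_le[OF q, of p] w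
    by simp_all
  show "norm (heat_ker_hess p z \<sigma> h) \<le> w \<omega> * norm h"
    by (rule order_trans[OF norm_heat_ker_hess_le[OF q]]) (auto intro!: mult_right_mono w)
  show "norm (heat_ker_third p z \<sigma> h k) \<le> w \<omega> * norm h * norm k"
    by (rule order_trans[OF norm_heat_ker_third_le[OF q]]) (auto intro!: mult_right_mono w)
  show "\<bar>heat_ker p z \<sigma> * ((norm z / \<sigma>)\<^sup>2 / 4 - p / \<sigma>)\<bar> \<le> (1 + p) * w \<omega>"
    by (rule order_trans[OF heat_ker_time_deriv_le[OF q p]]) (use p in \<open>auto intro!: mult_left_mono w\<close>)
qed

text \<open>The mean value inequality on the unit ball with the Hessian bound; this is the Lipschitz
  premise for differentiating \<Phi> under the integral.\<close>

lemma lipschitz_grad: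
  assumes "norm x < 1" "norm y < 1" "\<bar>t\<bar> < 1" "\<omega> \<in> space M"
  shows "norm (heat_ker_grad p (x - fst \<omega>) (t - snd \<omega>) - heat_ker_grad p (y - fst \<omega>) (t - snd \<omega>))
    \<le> w \<omega> * norm (x - y)"
proof (rule differentiable_bound[of "ball 0 1"])
  show "((\<lambda>x. heat_ker_grad p (x - fst \<omega>) (t - snd \<omega>)) has_derivative
      heat_ker_hess p (z - fst \<omega>) (t - snd \<omega>)) (at z within ball 0 1)" for z
    by (rule has_derivative_at_withinI[OF has_derivative_translate[OF has_derivative_heat_ker_grad]])
qed (use assms in \<open>auto intro!: onorm_le pointwise_bounds(4)\<close>)

text \<open>The same argument one order higher. It serves both to differentiate \<Gamma> and to show
  that \<open>H\<close> is continuous.\<close>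

lemma lipschitz_hess:
  assumes "norm x < 1" "norm y < 1" "\<bar>t\<bar> < 1" "\<omega> \<in> space M"
  shows "norm (heat_ker_hess p (x - fst \<omega>) (t - snd \<omega>) h - heat_ker_hess p (y - fst \<omega>) (t - snd \<omega>) h)
    \<le> w \<omega> * norm h * norm (x - y)"
proof (rule differentiable_bound[of "ball 0 1"])
  show "((\<lambda>x. heat_ker_hess p (x - fst \<omega>) (t - snd \<omega>) h) has_derivative
      heat_ker_third p (z - fst \<omega>) (t - snd \<omega>) h) (at z within ball 0 1)" for z
    by (rule has_derivative_at_withinI[OF has_derivative_translate[OF has_derivative_heat_ker_hess]])
qed (use assms in \<open>auto intro!: onorm_le pointwise_bounds(5)\<close>)

lemma lipschitz_time:
  assumes "norm x < 1" "\<bar>s\<bar> < 1" "\<bar>t\<bar> < 1" "s \<le> t" "\<omega> \<in> space M"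
  shows "\<bar>heat_ker p (x - fst \<omega>) (t - snd \<omega>) - heat_ker p (x - fst \<omega>) (s - snd \<omega>)\<bar>
    \<le> (1 + p) * w \<omega> * (t - s)"
proof -
  consider "t \<le> snd \<omega>" | "s \<le> snd \<omega>" "snd \<omega> < t" | "snd \<omega> < s" by linarith
  then show ?thesis
  proof cases
    case 1
    then show ?thesis using assms p w_nonneg[of \<omega>] by (simp add: heat_ker_def)
  next
    case 2
    let ?\<sigma> = "t - snd \<omega>"
    \<comment> \<open>The source starts to act between \<open>s\<close> and \<open>t\<close>, so the
      elapsed time is at most \<open>t - s\<close>; dividing the kernel by it still leaves a
      quantity below \<open>w \<omega>\<close>.\<close>
    have "heat_ker p (x - fst \<omega>) ?\<sigma> = ?\<sigma> * (1 / ?\<sigma> * heat_ker p (x - fst \<omega>) ?\<sigma>)" using 2 by simp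
    also have "\<dots> \<le> ?\<sigma> * w \<omega>" using 2 pointwise_bounds(2)[OF assms(1,3,5)] by (intro mult_left_mono) auto
    also have "\<dots> \<le> (t - s) * ((1 + p) * w \<omega>)"
      using 2 p w_nonneg[of \<omega>] by (intro mult_mono) (auto simp: mult_le_cancel_right1)
    finally show ?thesis using 2 heat_ker_nonneg[of p "x - fst \<omega>" ?\<sigma>] by (simp add: heat_ker_def[of p _ "s - _"] mult_ac)
  next
    case 3
    have "norm (heat_ker p (x - fst \<omega>) (t - snd \<omega>) - heat_ker p (x - fst \<omega>) (s - snd \<omega>))
      \<le> (1 + p) * w \<omega> * norm ((t - snd \<omega>) - (s - snd \<omega>))"
    proof (rule field_differentiable_bound[of "{s - snd \<omega>..t - snd \<omega>}"])
      fix \<sigma> assume \<sigma>: "\<sigma> \<in> {s - snd \<omega>..t - snd \<omega>}"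
      show "((\<lambda>\<sigma>. heat_ker p (x - fst \<omega>) \<sigma>) has_field_derivative
          heat_ker p (x - fst \<omega>) \<sigma> * ((norm (x - fst \<omega>) / \<sigma>)\<^sup>2 / 4 - p / \<sigma>)) (at \<sigma> within {s - snd \<omega>..t - snd \<omega>})"
        by (rule has_field_derivative_at_within[OF has_real_derivative_heat_ker_time]) (use 3 \<sigma> in auto)
      \<comment> \<open>This is the intermediate time between \<open>s\<close> and \<open>t\<close>
        at which the bound on the time derivative is applied.\<close>
      have "\<bar>\<sigma> + snd \<omega>\<bar> < 1" using \<sigma> assms by auto
      then show "norm (heat_ker p (x - fst \<omega>) \<sigma> * ((norm (x - fst \<omega>) / \<sigma>)\<^sup>2 / 4 - p / \<sigma>)) \<le> (1 + p) * w \<omega>"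
        using pointwise_bounds(6)[of x "\<sigma> + snd \<omega>" \<omega>] assms by simp
    qed (use assms in auto)
    then show ?thesis using assms by simp
  qed
qed

section \<open>Integrated bounds and derivatives of the potential\<close>

lemma measurable_kernels [measurable]:
  "(\<lambda>\<omega>. heat_ker p (x - fst \<omega>) (t - snd \<omega>)) \<in> borel_measurable M"
  "(\<lambda>\<omega>. heat_ker_grad p (x - fst \<omega>) (t - snd \<omega>)) \<in> borel_measurable M"
  "(\<lambda>\<omega>. heat_ker_hess p (x - fst \<omega>) (t - snd \<omega>) h) \<in> borel_measurable M"
  unfolding heat_ker_grad_def heat_ker_hess_def by measurable

lemma integrable_kernels:
  assumes "norm x < 1" "\<bar>t\<bar> < 1"
  shows "integrable M (\<lambda>\<omega>. heat_ker p (x - fst \<omega>) (t - snd \<omega>))"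
    and "integrable M (\<lambda>\<omega>. heat_ker_grad p (x - fst \<omega>) (t - snd \<omega>))"
    and "integrable M (\<lambda>\<omega>. heat_ker_hess p (x - fst \<omega>) (t - snd \<omega>) h)"
proof -
  show "integrable M (\<lambda>\<omega>. heat_ker p (x - fst \<omega>) (t - snd \<omega>))"
    by (rule Bochner_Integration.integrable_bound[OF integrable_w])
      (use pointwise_bounds(1)[OF assms] w_nonneg in \<open>auto simp: heat_ker_nonneg\<close>)
  show "integrable M (\<lambda>\<omega>. heat_ker_grad p (x - fst \<omega>) (t - snd \<omega>))"
    by (rule Bochner_Integration.integrable_bound[OF integrable_w])
      (use pointwise_bounds(3)[OF assms] w_nonneg in auto)
  show "integrable M (\<lambda>\<omega>. heat_ker_hess p (x - fst \<omega>) (t - snd \<omega>) h)"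
    by (rule Bochner_Integration.integrable_bound[of M "\<lambda>\<omega>. w \<omega> * norm h"])
      (use pointwise_bounds(4)[OF assms] w_nonneg integrable_w in auto)
qed

lemma norm_integral_le:
  fixes g :: "'a \<times> real \<Rightarrow> 'b::{banach,second_countable_topology}"
  assumes "integrable M g" "\<And>\<omega>. \<omega> \<in> space M \<Longrightarrow> norm (g \<omega>) \<le> w \<omega> * c"
  shows "norm (\<integral>\<omega>. g \<omega> \<partial>M) \<le> W * c"
proof -
  have "norm (\<integral>\<omega>. g \<omega> \<partial>M) \<le> (\<integral>\<omega>. w \<omega> * c \<partial>M)"
    by (rule order_trans[OF integral_norm_bound integral_mono]) (use assms integrable_w in auto)
  then show ?thesis by (simp add: W_def)
qed

lemma \<Phi>_bounds:
  assumes "norm x < 1" "\<bar>t\<bar> < 1"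
  shows "\<bar>\<Phi> x t\<bar> \<le> W" "norm (\<Gamma> x t) \<le> W" "norm (H x t h) \<le> W * norm h"
proof -
  show "\<bar>\<Phi> x t\<bar> \<le> W"
    unfolding \<Phi>_def using norm_integral_le[OF integrable_kernels(1)[OF assms], of 1] pointwise_bounds(1)[OF assms]
    by (simp add: heat_ker_nonneg)
  show "norm (\<Gamma> x t) \<le> W"
    unfolding \<Gamma>_def using norm_integral_le[OF integrable_kernels(2)[OF assms], of 1] pointwise_bounds(3)[OF assms]
    by simp
  show "norm (H x t h) \<le> W * norm h"
    unfolding H_def by (intro norm_integral_le integrable_kernels pointwise_bounds assms)
qed

lemma H_lipschitz:
  assumes "norm x < 1" "norm y < 1" "\<bar>t\<bar> < 1"
  shows "norm (H x t h - H y t h) \<le> W * (norm h * norm (x - y))"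
proof -
  have "H x t h - H y t h = (\<integral>\<omega>. heat_ker_hess p (x - fst \<omega>) (t - snd \<omega>) h - heat_ker_hess p (y - fst \<omega>) (t - snd \<omega>) h \<partial>M)"
    using assms by (simp add: H_def integrable_kernels)
  also have "norm \<dots> \<le> W * (norm h * norm (x - y))"
    using lipschitz_hess[OF assms] assms
    by (intro norm_integral_le) (auto simp: mult.assoc integrable_kernels)
  finally show ?thesis .
qed

lemma \<Phi>_lipschitz_time:
  assumes "norm x < 1" "\<bar>s\<bar> < 1" "\<bar>t\<bar> < 1"
  shows "\<bar>\<Phi> x s - \<Phi> x t\<bar> \<le> W * ((1 + p) * \<bar>s - t\<bar>)"
  using assms
proof (induction s t rule: linorder_wlog)
  case (le s t)
  have "\<Phi> x t - \<Phi> x s = (\<integral>\<omega>. heat_ker p (x - fst \<omega>) (t - snd \<omega>) - heat_ker p (x - fst \<omega>) (s - snd \<omega>) \<partial>M)"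
    using le by (simp add: \<Phi>_def integrable_kernels)
  also have "norm \<dots> \<le> W * ((1 + p) * (t - s))"
    using lipschitz_time[OF le(2-4,1)] le
    by (intro norm_integral_le) (auto simp: mult_ac integrable_kernels)
  finally show ?case using le by (simp add: abs_minus_commute)
qed (simp add: abs_minus_commute)

lemma \<Phi>_has_derivative:
  assumes "norm x < 1" "\<bar>t\<bar> < 1"
  shows "((\<lambda>x. \<Phi> x t) has_derivative (\<lambda>h. \<Gamma> x t \<bullet> h)) (at x)"
proof -
  have "((\<lambda>x. \<Phi> x t) has_derivative (\<lambda>h. \<integral>\<omega>. heat_ker_grad p (x - fst \<omega>) (t - snd \<omega>) \<bullet> h \<partial>M)) (at x)"
    unfolding \<Phi>_def
  proof (rule has_derivative_integral_lipschitz[of "ball 0 1" _ M _ _ w])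
    fix y y' :: 'a and \<omega> and h :: 'a assume *: "y \<in> ball 0 1" "y' \<in> ball 0 1" "\<omega> \<in> space M"
    have "norm (heat_ker_grad p (y - fst \<omega>) (t - snd \<omega>) \<bullet> h - heat_ker_grad p (y' - fst \<omega>) (t - snd \<omega>) \<bullet> h)
      \<le> norm (heat_ker_grad p (y - fst \<omega>) (t - snd \<omega>) - heat_ker_grad p (y' - fst \<omega>) (t - snd \<omega>)) * norm h"
      unfolding inner_diff_left[symmetric] by (simp add: Cauchy_Schwarz_ineq2)
    also have "\<dots> \<le> w \<omega> * norm (y - y') * norm h"
      using * assms by (intro mult_right_mono lipschitz_grad) auto
    finally show "norm (heat_ker_grad p (y - fst \<omega>) (t - snd \<omega>) \<bullet> h - heat_ker_grad p (y' - fst \<omega>) (t - snd \<omega>) \<bullet> h)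
      \<le> w \<omega> * norm (y - y') * norm h" .
  qed (use assms in \<open>auto simp: integrable_w w_nonneg integrable_kernels
      intro!: has_derivative_translate has_derivative_heat_ker\<close>)
  then show ?thesis
    using integrable_kernels(2)[OF assms] by (simp add: \<Gamma>_def)
qed

lemma \<Gamma>_has_derivative:
  assumes "norm x < 1" "\<bar>t\<bar> < 1"
  shows "((\<lambda>x. \<Gamma> x t) has_derivative H x t) (at x)"
  unfolding \<Gamma>_def H_def
proof (rule has_derivative_integral_lipschitz[of "ball 0 1" _ M _ _ w])
  fix y y' :: 'a and \<omega> and h :: 'a assume *: "y \<in> ball 0 1" "y' \<in> ball 0 1" "\<omega> \<in> space M"
  then show "norm (heat_ker_hess p (y - fst \<omega>) (t - snd \<omega>) h - heat_ker_hess p (y' - fst \<omega>) (t - snd \<omega>) h)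
    \<le> w \<omega> * norm (y - y') * norm h"
    using lipschitz_hess[of y y' t \<omega> h] assms by (simp add: mult_ac)
qed (use assms in \<open>auto simp: integrable_w w_nonneg integrable_kernels
    intro!: has_derivative_translate has_derivative_heat_ker_grad\<close>)

end

section \<open>Norms of the potential on the unit cylinder\<close>

lemma cylinder_1:
  "snd ` cylinder 1 (0::'a::euclidean_space) 0 = {-1<..<1}"
  "fst ` cylinder 1 (0::'a) 0 = ball 0 1"
  "\<bar>t\<bar> < 1 \<Longrightarrow> {x. (x, t) \<in> cylinder 1 (0::'a) 0} = ball 0 1"
  "norm x < 1 \<Longrightarrow> {t. (x, t) \<in> cylinder 1 (0::'a) 0} = {-1<..<1}"
proof -
  have eq: "cylinder 1 (0::'a) 0 = ball 0 1 \<times> {-1<..<1}"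
    by (auto simp: cylinder_def abs_less_iff)
  show "snd ` cylinder 1 (0::'a) 0 = {-1<..<1}" "fst ` cylinder 1 (0::'a) 0 = ball 0 1"
    "\<bar>t\<bar> < 1 \<Longrightarrow> {x. (x, t) \<in> cylinder 1 (0::'a) 0} = ball 0 1"
    "norm x < 1 \<Longrightarrow> {t. (x, t) \<in> cylinder 1 (0::'a) 0} = {-1<..<1}"
    unfolding eq by (auto simp: snd_image_times fst_image_times)
qed

context past_sources
begin

text \<open>Derivatives are local, so agreement with \<Phi> on the open cylinder suffices. The
  gradient is identified on the whole ball first, because differentiating it at \<open>x\<close>
  requires its values nearby.\<close>

lemma
  fixes v :: "'a \<times> real \<Rightarrow> real"
  assumes v: "\<And>x t. norm x < 1 \<Longrightarrow> \<bar>t\<bar> < 1 \<Longrightarrow> v (x, t) = \<Phi> x t"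
    and x: "norm x < 1" and t: "\<bar>t\<bar> < 1"
  shows differentiable_slice: "(\<lambda>x. v (x, t)) differentiable at x"
    and grad_slice: "grad (\<lambda>x. v (x, t)) x = \<Gamma> x t"
    and differentiable_grad_slice: "grad (\<lambda>x. v (x, t)) differentiable at x"
    and hess_slice: "hess (\<lambda>x. v (x, t)) x = H x t"
proof -
  have der: "((\<lambda>x. v (x, t)) has_derivative (\<lambda>h. \<Gamma> x t \<bullet> h)) (at x)" if "norm x < 1" for x
    by (rule has_derivative_transform_within_open[OF \<Phi>_has_derivative[OF that t], of "ball 0 1"])
      (use that v t in auto)
  have grad: "grad (\<lambda>x. v (x, t)) x = \<Gamma> x t" if "norm x < 1" for x
    unfolding grad_def frechet_derivative_at[OF der[OF that], symmetric]
    by (rule euclidean_representation)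
  have der2: "(grad (\<lambda>x. v (x, t)) has_derivative H x t) (at x)"
    by (rule has_derivative_transform_within_open[OF \<Gamma>_has_derivative[OF x t], of "ball 0 1"])
      (use grad x in auto)
  show "(\<lambda>x. v (x, t)) differentiable at x" using der[OF x] by (auto simp: differentiable_def)
  show "grad (\<lambda>x. v (x, t)) x = \<Gamma> x t" by (rule grad[OF x])
  show "grad (\<lambda>x. v (x, t)) differentiable at x" using der2 by (auto simp: differentiable_def)
  show "hess (\<lambda>x. v (x, t)) x = H x t"
    unfolding hess_def by (rule frechet_derivative_at[OF der2, symmetric])
qed

lemma continuous_on_H:
  assumes "\<bar>t\<bar> < 1"
  shows "continuous_on (ball 0 1) (\<lambda>x. H x t h)"
proof (rule lipschitz_on_continuous_on)
  show "(W * norm h)-lipschitz_on (ball 0 1) (\<lambda>x. H x t h)"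
    using H_lipschitz[OF _ _ assms] W_nonneg
    by (intro lipschitz_onI) (auto simp: dist_norm mult.assoc)
qed

lemma C2_norm_slice_le:
  assumes v: "\<And>x t. norm x < 1 \<Longrightarrow> \<bar>t\<bar> < 1 \<Longrightarrow> v (x, t) = \<Phi> x t" and t: "\<bar>t\<bar> < 1"
  shows "C2_norm (ball 0 1) (\<lambda>x. v (x, t)) \<le> ennreal (3 * W)"
proof -
  have "onorm (H x t) \<le> W" if "norm x < 1" for x
    by (rule onorm_le) (rule \<Phi>_bounds[OF that t])
  then have "C2_norm (ball 0 1) (\<lambda>x. v (x, t)) \<le> ennreal W + ennreal W + ennreal W"
    unfolding C2_norm_def
    by (intro add_mono SUP_least ennreal_leI) (auto simp: v t \<Phi>_bounds grad_slice[OF v] hess_slice[OF v])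
  also have "\<dots> = ennreal (3 * W)" using W_nonneg by (simp flip: ennreal_plus)
  finally show ?thesis .
qed

lemma Calpha_norm_slice_le:
  assumes v: "\<And>x t. norm x < 1 \<Longrightarrow> \<bar>t\<bar> < 1 \<Longrightarrow> v (x, t) = \<Phi> x t" and x: "norm x < 1"
    and \<alpha>: "0 < \<alpha>" "\<alpha> < 1"
  shows "Calpha_norm \<alpha> {-1<..<1} (\<lambda>t. v (x, t)) \<le> ennreal ((3 + 2 * p) * W)"
proof -
  have "\<bar>\<Phi> x t - \<Phi> x s\<bar> / \<bar>t - s\<bar> powr \<alpha> \<le> 2 * (1 + p) * W"
    if "\<bar>t\<bar> < 1" "\<bar>s\<bar> < 1" "t \<noteq> s" for t s
  proof -
    have d: "0 < \<bar>t - s\<bar>" "\<bar>t - s\<bar> \<le> 2" using that by auto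
    have "\<bar>t - s\<bar> powr (1 - \<alpha>) \<le> 2 powr (1 - \<alpha>)" using d \<alpha> by (intro powr_mono2) auto
    also have "\<dots> \<le> 2 powr 1" using \<alpha> by (intro powr_mono) auto
    \<comment> \<open>Two times in the unit cylinder differ by at most 2, so the Lipschitz bound in
      time implies the Hoelder bound with a constant independent of \<alpha>.\<close>
    finally have le2: "\<bar>t - s\<bar> powr (1 - \<alpha>) \<le> 2" by simp
    have "\<bar>\<Phi> x t - \<Phi> x s\<bar> / \<bar>t - s\<bar> powr \<alpha> \<le> W * ((1 + p) * \<bar>t - s\<bar>) / \<bar>t - s\<bar> powr \<alpha>"
      by (intro divide_right_mono \<Phi>_lipschitz_time x that) auto
    also have "\<dots> = W * (1 + p) * \<bar>t - s\<bar> powr (1 - \<alpha>)"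
      using d by (simp add: powr_diff)
    also have "\<dots> \<le> W * (1 + p) * 2"
      using W_nonneg p by (intro mult_left_mono le2) auto
    finally show ?thesis by (simp add: algebra_simps)
  qed
  then have "Calpha_norm \<alpha> {-1<..<1} (\<lambda>t. v (x, t)) \<le> ennreal W + ennreal (2 * (1 + p) * W)"
    unfolding Calpha_norm_def
    by (intro add_mono SUP_least) (auto intro!: ennreal_leI simp: v x \<Phi>_bounds(1) abs_less_iff)
  also have "\<dots> = ennreal ((3 + 2 * p) * W)"
    using W_nonneg p by (simp add: algebra_simps flip: ennreal_plus)
  finally show ?thesis .
qed

lemma C2alpha_norm_le:
  assumes v: "\<And>x t. norm x < 1 \<Longrightarrow> \<bar>t\<bar> < 1 \<Longrightarrow> v (x, t) = \<Phi> x t"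
    and \<alpha>: "0 < \<alpha>" "\<alpha> < 1"
  shows "C2alpha_norm \<alpha> (cylinder 1 0 0) v \<le> ennreal ((6 + 2 * p) * W)"
proof -
  have "C2alpha_norm \<alpha> (cylinder 1 0 0) v \<le> ennreal (3 * W) + ennreal ((3 + 2 * p) * W)"
    unfolding C2alpha_norm_def cylinder_1(1,2)
    by (intro add_mono SUP_least)
      (auto simp: cylinder_1(3,4) abs_less_iff intro!: C2_norm_slice_le v Calpha_norm_slice_le \<alpha>)
  also have "\<dots> = ennreal ((6 + 2 * p) * W)"
    using W_nonneg p by (simp add: algebra_simps flip: ennreal_plus)
  finally show ?thesis .
qed

lemma in_C2alpha_space:
  assumes v: "\<And>x t. norm x < 1 \<Longrightarrow> \<bar>t\<bar> < 1 \<Longrightarrow> v (x, t) = \<Phi> x t"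
    and \<alpha>: "0 < \<alpha>" "\<alpha> < 1"
  shows "v \<in> C2alpha_space \<alpha> (cylinder 1 0 0)"
proof -
  have "C2_on {x. (x, t) \<in> cylinder 1 0 0} (\<lambda>x. v (x, t))" if t: "\<bar>t\<bar> < 1" for t
    unfolding cylinder_1(3)[OF t] C2_on_def
  proof (intro conjI ballI allI)
    show "continuous_on (ball 0 1) (\<lambda>x. hess (\<lambda>x. v (x, t)) x h)" for h
      by (rule continuous_on_cong[THEN iffD1, OF refl _ continuous_on_H[OF t]])
        (simp add: hess_slice[OF v] t)
  qed (auto intro!: differentiable_slice differentiable_grad_slice v t)
  moreover have "C2alpha_norm \<alpha> (cylinder 1 0 0) v < \<infinity>"
    using C2alpha_norm_le[OF v \<alpha>] by (simp add: order_le_less_trans)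
  ultimately show ?thesis
    unfolding C2alpha_space_def cylinder_1(1) by (auto simp: abs_less_iff)
qed

end

subsection \<open>Representation of the potential\<close>

text \<open>Local integrability makes each truncation to a ball measurable, and at every point the
  truncations eventually equal \<open>u\<close>.\<close>

lemma borel_measurable_L_class:
  assumes "u \<in> L_class s"
  shows "u \<in> borel_measurable borel"
proof (rule borel_measurable_LIMSEQ_real)
  fix n :: nat
  have "set_integrable lborel (cball 0 (real n)) u"
    using assms by (simp add: L_class_def)
  then show "(\<lambda>z. indicator (cball 0 (real n)) z * u z) \<in> borel_measurable borel"
    by (simp add: set_integrable_def borel_measurable_integrable)
next
  fix z
  have "\<forall>\<^sub>F n in sequentially. indicator (cball 0 (real n)) z * u z = u z"
    using eventually_ge_at_top[of "nat \<lceil>norm z\<rceil>"]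
    by eventually_elim (simp add: le_nat_iff ceiling_le_iff nat_le_iff)
  then show "(\<lambda>n. indicator (cball 0 (real n)) z * u z) \<longlonglongrightarrow> u z"
    by (rule tendsto_eventually)
qed

text \<open>
  The theorem does not assume that \<open>f\<close> is measurable, but without this Tonelli's theorem would not
  apply to the potential of \<open>f\<close>.
\<close>

lemma borel_measurable_frac_heat:
  fixes u f :: "(real^'n) \<times> real \<Rightarrow> real"
  assumes u: "u \<in> borel_measurable borel" and f: "\<And>z. has_frac_heat s u z (f z)"
  shows "f \<in> borel_measurable borel"
proof -
  define g where "g = (\<lambda>x t \<tau> y. (u (x, t) - u (y, \<tau>)) / (t - \<tau>) powr (real CARD('n) / 2 + 1 + s)
                 * exp (- (norm (x - y))\<^sup>2 / (4 * (t - \<tau>))))"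
  \<comment> \<open>The inner integrals \<open>I\<close> are chosen for each point separately, which
    gives no measurability in \<open>z\<close>. The limit along the radii
    \<open>1 / real (Suc k)\<close> is jointly measurable in \<open>z\<close> and \<tau>, and it
    equals \<open>I \<tau>\<close> wherever the principal value exists.\<close>
  define L where "L = (\<lambda>z \<tau>. lim (\<lambda>k. LINT y|lborel. (if 1 / real (Suc k) < norm (y - fst z) then g (fst z) (snd z) \<tau> y else 0)))"
  have [measurable]: "u \<in> borel_measurable (borel \<Otimes>\<^sub>M borel)" using u by (simp add: borel_prod)
  have L: "case_prod L \<in> borel_measurable ((borel \<Otimes>\<^sub>M borel) \<Otimes>\<^sub>M lborel)"
    unfolding L_def g_def by measurable
  have "f z = C_const TYPE('n) s * (LINT \<tau>|lborel. (if \<tau> < snd z then L z \<tau> else 0))" for z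
  proof -
    obtain x t where z: "z = (x, t)" by force
    obtain I where I: "AE \<tau> in lborel. \<tau> < t \<longrightarrow> has_pv_integral (g x t \<tau>) x (I \<tau>)"
      "set_integrable lborel {..<t} I" "f z = C_const TYPE('n) s * (LINT \<tau>:{..<t}|lborel. I \<tau>)"
      using f[of z] unfolding has_frac_heat_def z g_def by auto
    have lim: "L z \<tau> = I \<tau>" if "has_pv_integral (g x t \<tau>) x (I \<tau>)" for \<tau>
    proof -
      have "filterlim (\<lambda>k. 1 / real (Suc k)) (at_right 0) sequentially"
        by (rule tendsto_imp_filterlim_at_right[OF lim_1_over_n[THEN LIMSEQ_Suc]]) simp
      note filterlim_compose[OF that[unfolded has_pv_integral_def, THEN conjunct2] this]
      moreover have "(LINT y:{y. \<epsilon> < norm (y - x)}|lborel. g x t \<tau> y) =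
          (LINT y|lborel. (if \<epsilon> < norm (y - x) then g x t \<tau> y else 0))" for \<epsilon>
        unfolding set_lebesgue_integral_def by (intro Bochner_Integration.integral_cong) auto
      ultimately show ?thesis unfolding L_def z fst_conv snd_conv by (intro limI) simp
    qed
    have "(LINT \<tau>:{..<t}|lborel. I \<tau>) = (LINT \<tau>|lborel. (if \<tau> < snd z then L z \<tau> else 0))"
      unfolding set_lebesgue_integral_def
    proof (rule integral_cong_AE)
      show "(\<lambda>\<tau>. indicator {..<t} \<tau> *\<^sub>R I \<tau>) \<in> borel_measurable lborel"
        using I(2) by (simp add: set_integrable_def borel_measurable_integrable)
      have [measurable]: "L z \<in> borel_measurable lborel"
        using measurable_Pair2[OF L, of z] by (simp add: borel_prod)
      show "(\<lambda>\<tau>. if \<tau> < snd z then L z \<tau> else 0) \<in> borel_measurable lborel" by measurable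
      show "AE \<tau> in lborel. indicator {..<t} \<tau> *\<^sub>R I \<tau> = (if \<tau> < snd z then L z \<tau> else 0)"
        using I(1) by eventually_elim (auto simp: z lim[unfolded z])
    qed
    with I(3) show ?thesis by simp
  qed
  then have "f = (\<lambda>z. C_const TYPE('n) s * (LINT \<tau>|lborel. (if \<tau> < snd z then L z \<tau> else 0)))" by blast
  also have "\<dots> \<in> borel_measurable (borel \<Otimes>\<^sub>M borel)"
    using L by measurable
  finally show ?thesis by (simp add: borel_prod)
qed

text \<open>Tonelli merges the iterated integral into one over space-time. The restriction to past
  times is built into \<open>heat_ker\<close>, the cutoff on \<open>Q\<close> and the weight
  \<open>f\<close> into the measure; what remains is the bare kernel, as in
  \<open>past_sources\<close>.\<close>

lemma potential_eq_nn_integral: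
  fixes f :: "(real^'n) \<times> real \<Rightarrow> real"
  assumes f [measurable]: "f \<in> borel_measurable borel" and f0: "\<And>z. f z \<ge> 0"
    and Q: "Q \<in> sets borel"
  shows "potential s (\<lambda>z. if z \<in> Q then 0 else f z) (x, t) =
    (\<integral>\<^sup>+\<omega>. ennreal (heat_ker (real CARD('n) / 2 + 1 - s) (x - fst \<omega>) (t - snd \<omega>))
      \<partial>density (restrict_space lborel (- Q)) (\<lambda>z. ennreal (C_const TYPE('n) s * f z)))"
proof -
  define c where "c = C_const TYPE('n) s"
  define p where "p = real CARD('n) / 2 + 1 - s"
  define h where "h = (\<lambda>\<omega>. ennreal ((if \<omega> \<in> Q then 0 else f \<omega>) * (c * heat_ker p (x - fst \<omega>) (t - snd \<omega>))))"
  have c: "c \<ge> 0" by (simp add: c_def C_const_def)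
  have G: "G_kernel s y \<sigma> = c * heat_ker p y \<sigma>" if "\<sigma> > 0" for y :: "real^'n" and \<sigma>
    using that by (simp add: G_kernel_def heat_ker_def c_def p_def)
  have [measurable]: "(\<lambda>\<omega>. heat_ker p (x - fst \<omega>) (t - snd \<omega>)) \<in> borel_measurable (borel :: (_ \<times> real) measure)"
    unfolding borel_prod[symmetric] by measurable
  have [measurable]: "Q \<in> sets borel" by (rule Q)
  have h: "h \<in> borel_measurable (lborel \<Otimes>\<^sub>M lborel)"
    unfolding lborel_prod h_def by measurable
  have "potential s (\<lambda>z. if z \<in> Q then 0 else f z) (x, t) = (\<integral>\<^sup>+\<tau>. (\<integral>\<^sup>+y. h (y, \<tau>) \<partial>lborel) \<partial>lborel)"
    unfolding potential_def prod.case
    by (intro nn_integral_cong) (auto simp: indicator_def h_def G heat_ker_def intro!: nn_integral_cong)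
  also have "\<dots> = integral\<^sup>N lborel h"
    using lborel_pair.nn_integral_snd[OF h] by (simp add: lborel_prod)
  also have "\<dots> = (\<integral>\<^sup>+\<omega>\<in>-Q. ennreal (c * f \<omega>) * ennreal (heat_ker p (x - fst \<omega>) (t - snd \<omega>)) \<partial>lborel)"
    by (intro nn_integral_cong)
      (auto simp: h_def indicator_def mult_ac f0 c heat_ker_nonneg simp flip: ennreal_mult)
  also have "\<dots> = (\<integral>\<^sup>+\<omega>. ennreal (c * f \<omega>) * ennreal (heat_ker p (x - fst \<omega>) (t - snd \<omega>)) \<partial>restrict_space lborel (-Q))"
    by (intro nn_integral_restrict_space[symmetric]) simp
  also have "\<dots> = (\<integral>\<^sup>+\<omega>. ennreal (heat_ker p (x - fst \<omega>) (t - snd \<omega>))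
      \<partial>density (restrict_space lborel (- Q)) (\<lambda>z. ennreal (c * f z)))"
    by (intro nn_integral_density[symmetric]) (auto intro!: measurable_restrict_space1)
  finally show ?thesis by (simp add: c_def p_def)
qed

section \<open>Choice of the reference point and conclusion\<close>

lemma open_cylinder: "open (cylinder r x0 t0)"
  unfolding cylinder_def case_prod_beta by (intro open_Collect_conj open_Collect_less continuous_intros)

text \<open>If every point of \<open>U\<close> exceeded the essential supremum, \<open>U\<close>
  would be a null set, which a nonempty open set is not.\<close>

lemma ex_le_Linf_norm:
  assumes "open U" "U \<noteq> {}" "U \<subseteq> \<Omega>" "open \<Omega>"
  shows "\<exists>z\<in>U. ennreal \<bar>v z\<bar> \<le> Linf_norm \<Omega> v"
proof (rule ccontr)
  assume *: "\<not> (\<exists>z\<in>U. ennreal \<bar>v z\<bar> \<le> Linf_norm \<Omega> v)"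
  have "AE z in restrict_space lborel \<Omega>. ennreal \<bar>v z\<bar> \<le> Linf_norm \<Omega> v"
    unfolding Linf_norm_def by (rule esssup_AE)
  then have "AE z in lborel. z \<in> \<Omega> \<longrightarrow> ennreal \<bar>v z\<bar> \<le> Linf_norm \<Omega> v"
    using assms by (subst (asm) AE_restrict_space_iff) auto
  then have "AE z in lborel. z \<notin> U"
    by eventually_elim (use * assms in blast)
  then have "U \<in> null_sets lborel"
    using assms by (simp add: AE_iff_null_sets)
  then have "negligible U"
    by (simp add: negligible_iff_null_sets null_sets_completionI)
  then show False using open_not_negligible assms by blast
qed

theorem theorem4:
  fixes s \<alpha> :: real
  assumes "0 < s" "s < 1" "0 < \<alpha>" "\<alpha> < 1"
  shows "\<exists>C>0. \<forall>u f :: (real^'n) \<times> real \<Rightarrow> real.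
    (let Q = cylinder 2 (0 :: real^'n) 0;
         Q' = cylinder 1 (0 :: real^'n) 0;
         V = potential s (\<lambda>z. if z \<in> Q then 0 else f z);
         v = (\<lambda>z. enn2real (V z))
     in (\<forall>z. f z \<ge> 0) \<longrightarrow> (\<forall>z. u z \<ge> 0) \<longrightarrow> classical_entire_solution s u f \<longrightarrow>
        (\<exists>M::real. \<forall>z\<in>Q. V z \<le> ennreal M) \<longrightarrow>
        v \<in> C2alpha_space \<alpha> Q' \<and> C2alpha_norm \<alpha> Q' v \<le> ennreal C * Linf_norm Q v)"
proof -
  define p where "p = real CARD('n) / 2 + 1 - s"
  have p: "p > 0" using assms by (simp add: p_def add_nonneg_pos)
  obtain A where A: "A > 0" and harnack: "\<And>(z::real^'n) z' \<sigma> \<delta>.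
      \<lbrakk>\<sigma> > 0; 1 \<le> \<delta>; \<delta> \<le> 4; norm (z' - z) \<le> 2; 1 \<le> \<sigma> \<or> 1 \<le> norm z\<rbrakk> \<Longrightarrow>
      (1 + norm z / \<sigma>) ^ 3 * heat_ker p z \<sigma> \<le> A * heat_ker p z' (\<sigma> + \<delta>)"
    using heat_ker_harnack[OF p] by metis
  define Q where "Q = cylinder 2 (0 :: real^'n) 0"
  \<comment> \<open>Candidates for the reference point: they lie in \<open>Q\<close>, whose times
    range over (-4, 4), and come after every time in (-1, 1) by more than 1 and less than 4.\<close>
  define U where "U = ball (0 :: real^'n) 1 \<times> {2<..<3::real}"
  \<comment> \<open>The first factor is the sum of the bounds for the two parts of the norm in units
    of \<open>W\<close>; the second comes from \<open>W\<close> being \<open>A\<close> times the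
    potential at the reference point. Both are fixed before \<open>u\<close> and
    \<open>f\<close>.\<close>
  define C where "C = (6 + 2 * p) * A"
  have "C > 0" using p A by (simp add: C_def)
  moreover have "v \<in> C2alpha_space \<alpha> (cylinder 1 0 0) \<and>
      C2alpha_norm \<alpha> (cylinder 1 0 0) v \<le> ennreal C * Linf_norm Q v"
    if f0: "\<And>z. f z \<ge> 0" and sol: "classical_entire_solution s u f"
      and bd: "\<And>z. z \<in> Q \<Longrightarrow> V z \<le> ennreal K"
      and V: "V = potential s (\<lambda>z. if z \<in> Q then 0 else f z)" and v: "v = (\<lambda>z. enn2real (V z))"
    for u f :: "(real^'n) \<times> real \<Rightarrow> real" and K V v
  proof -
    \<comment> \<open>The equation enters here: it expresses \<open>f\<close> through the measurable
      function \<open>u\<close>.\<close>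
    have [measurable]: "f \<in> borel_measurable borel"
      using sol borel_measurable_frac_heat[OF borel_measurable_L_class]
      by (auto simp: classical_entire_solution_def)
    have Q: "open Q" unfolding Q_def by (rule open_cylinder)
    have U: "open U" "U \<noteq> {}" "U \<subseteq> Q"
      by (auto simp: U_def Q_def cylinder_def open_Times intro!: exI[of _ "5/2"])
    define M where "M = density (restrict_space lborel (- Q)) (\<lambda>z. ennreal (C_const TYPE('n) s * f z))"
    have ident: "(\<lambda>\<omega>. \<omega>) \<in> borel_measurable M"
      unfolding M_def by (simp add: measurable_restrict_space1)
    have V_eq: "V (x, t) = (\<integral>\<^sup>+\<omega>. ennreal (heat_ker p (x - fst \<omega>) (t - snd \<omega>)) \<partial>M)" for x t
      unfolding V M_def p_def using Q f0 by (intro potential_eq_nn_integral) auto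
    have meas: "(\<lambda>\<omega>. heat_ker p (x - fst \<omega>) (t - snd \<omega>)) \<in> borel_measurable M" for x t
      by (rule measurable_compose[OF ident]) (unfold borel_prod[symmetric], measurable)
    \<comment> \<open>This holds even where the potential is infinite: \<open>enn2real\<close> of
      infinity and the integral of a nonintegrable function are both 0.\<close>
    have v_eq: "v (x, t) = (\<integral>\<omega>. heat_ker p (x - fst \<omega>) (t - snd \<omega>) \<partial>M)" for x t
      unfolding v V_eq by (rule integral_eq_nn_integral[symmetric]) (auto simp: meas heat_ker_nonneg)
    have sources: "past_sources p A M x t" if "(x, t) \<in> U" for x t
    proof
      show "space M \<inter> cylinder 2 0 0 = {}"
        by (auto simp: M_def space_restrict_space Q_def)
      have "V (x, t) < \<infinity>" 
        using order_le_less_trans[OF bd ennreal_less_top] U that by auto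
      then show "integrable M (\<lambda>\<omega>. heat_ker p (x - fst \<omega>) (t - snd \<omega>))"
        unfolding V_eq by (intro integrableI_bounded) (auto simp: meas heat_ker_nonneg)
    qed (use p A harnack ident that in \<open>auto simp: U_def\<close>)
    \<comment> \<open>All points of \<open>U\<close> can serve as reference point; this one is
      chosen so that its value, which controls the whole norm, does not exceed the essential
      supremum.\<close>
    obtain x t where z: "(x, t) \<in> U" "ennreal \<bar>v (x, t)\<bar> \<le> Linf_norm Q v"
      using ex_le_Linf_norm[OF U Q, of v] by auto
    interpret past_sources p A M x t by (rule sources[OF z(1)])
    have v\<Phi>: "v (y, \<tau>) = \<Phi> y \<tau>" for y \<tau> by (simp add: v_eq \<Phi>_def)
    have "C2alpha_norm \<alpha> (cylinder 1 0 0) v \<le> ennreal (C * v (x, t))"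
      using C2alpha_norm_le[OF v\<Phi>, of \<alpha>] assms by (simp add: W_eq C_def v\<Phi> mult.assoc)
    also have "\<dots> = ennreal C * ennreal \<bar>v (x, t)\<bar>"
      using \<open>C > 0\<close> by (simp add: v ennreal_mult)
    also have "\<dots> \<le> ennreal C * Linf_norm Q v" by (rule mult_left_mono[OF z(2)]) simp
    finally show ?thesis using in_C2alpha_space[OF v\<Phi>] assms by blast
  qed
  ultimately show ?thesis
    unfolding Let_def Q_def[symmetric] by blast
qed

end
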